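(* There is an algorithm that, given integers $n\ge 2$ and $g\ge 1$ and a probability vector $\boldsymbol{p}=(p_1,\dots,p_n)$ with $p_1\ge p_2\ge\dots\ge p_n>0$, solves the $g'$-length problem for $\boldsymbol{p}$ for all $1\le g'\le g$; that is, for each such $g'$ it outputs a binary prefix code for $n$ symbols that minimizes $\sum_{i=1}^n p_i l_i$ among all binary prefix codes for $n$ symbols whose codeword lengths $l_1,\dots,l_n$ take at most $g'$ distinct values (with no restriction on what these values are). The algorithm runs in $O(n^3(\log^g n)\,g^3)$ time and uses $O(n^2 g)$ space. In particular, for $g=2$ the two-length problem is solved in $O(n^3\log^2 n)$ time and $O(n^2)$ space.
   Context: A binary prefix code for $n$ symbols assigns to each symbol $i\in\{1,\dots,n\}$ a binary codeword of length $l_i\in\mathbb{Z}_+$ (positive integers) so that no codeword is a prefix of another; lengths $l_1,\dots,l_n$ are realizable if and only if the Kraft inequality $\sum_{i=1}^n 2^{-l_i}\le 1$ holds. The $g$-length problem is to find a prefix code of minimum expected length $\sum_i p_i l_i$ subject to using at most $g$ distinct codeword lengths, where the lengths themselves are free to be chosen. Here $\log^g n$ means $(\log_2 n)^g$. Computational model: arithmetic operations on real numbers and integers (including comparisons and bit shifts) take constant time, and each stored number takes unit space. *)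

theory Defs
  imports Complex_Main "HOL-Library.Landau_Symbols" "HOL-Library.Sublist"
begin

section \<open>Prefix codes with few codeword lengths\<close>

text \<open>
  A code for \<open>n\<close> symbols is a map on the symbols \<open>{1..n}\<close>; its values elsewhere are irrelevant.
\<close>

definition prefix_code :: "nat \<Rightarrow> (nat \<Rightarrow> bool list) \<Rightarrow> bool" where
  "prefix_code n c \<longleftrightarrow>
     (\<forall>i\<in>{1..n}. 0 < length (c i)) \<and>
     (\<forall>i\<in>{1..n}. \<forall>j\<in>{1..n}. i \<noteq> j \<longrightarrow> \<not> prefix (c i) (c j))"

definition codeword_lengths :: "nat \<Rightarrow> (nat \<Rightarrow> bool list) \<Rightarrow> nat set" where
  "codeword_lengths n c = (\<lambda>i. length (c i)) ` {1..n}"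

definition expected_length :: "nat \<Rightarrow> (nat \<Rightarrow> real) \<Rightarrow> (nat \<Rightarrow> bool list) \<Rightarrow> real" where
  "expected_length n p c = (\<Sum>i=1..n. p i * real (length (c i)))"

definition solves_length_problem ::
    "nat \<Rightarrow> nat \<Rightarrow> (nat \<Rightarrow> real) \<Rightarrow> (nat \<Rightarrow> bool list) \<Rightarrow> bool" where
  "solves_length_problem g n p c \<longleftrightarrow>
     is_arg_min (expected_length n p)
       (\<lambda>c'. prefix_code n c' \<and> card (codeword_lengths n c') \<le> g) c"

definition decreasing_probability_vector :: "nat \<Rightarrow> (nat \<Rightarrow> real) \<Rightarrow> bool" where
  "decreasing_probability_vector n p \<longleftrightarrow>
     (\<forall>i\<in>{1..n}. 0 < p i) \<and>
     (\<forall>i\<in>{1..n}. \<forall>j\<in>{1..n}. i \<le> j \<longrightarrow> p j \<le> p i) \<and>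
     (\<Sum>i=1..n. p i) = 1"


section \<open>The machine model\<close>

text \<open>
  A random access machine with two sorts of storage, integers and reals, programmed by while
  programs. A program addresses finitely many arrays, since array names are literals of the
  program text; a scalar variable is cell 0 of an array. The only real constants available are
  (images of) integers, and there is no operation, besides comparison, that leads from reals to
  integers; in particular there is no rounding.
\<close>

record store =
  imem :: "nat \<Rightarrow> nat \<Rightarrow> int"
  rmem :: "nat \<Rightarrow> nat \<Rightarrow> real"

datatype iop = IAdd | ISub | IMul | IDiv | IMod | IShl | IShr
datatype rop = RAdd | RSub | RMul | RDiv
datatype cmp = Less | LessEq | Equal

datatype iexp =
    IConst int
  | ILoad nat iexp
  | IOp iop iexp iexp

datatype rexp =
    ROfInt iexp
  | RLoad nat iexp
  | ROp rop rexp rexp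

datatype bexp =
    ICmp cmp iexp iexp
  | RCmp cmp rexp rexp
  | BNot bexp
  | BAnd bexp bexp

datatype com =
    Skip
  | IStore nat iexp iexp
  | RStore nat iexp rexp
  | Seq com com
  | Cond bexp com com
  | Loop bexp com

text \<open>
  Semantics of expressions. A negative address denotes cell 0, a negative shift distance means no
  shift, and division by zero follows the conventions of HOL.
\<close>

fun iop_sem :: "iop \<Rightarrow> int \<Rightarrow> int \<Rightarrow> int" where
  "iop_sem IAdd x y = x + y"
| "iop_sem ISub x y = x - y"
| "iop_sem IMul x y = x * y"
| "iop_sem IDiv x y = x div y"
| "iop_sem IMod x y = x mod y"
| "iop_sem IShl x y = push_bit (nat y) x"
| "iop_sem IShr x y = drop_bit (nat y) x"

fun rop_sem :: "rop \<Rightarrow> real \<Rightarrow> real \<Rightarrow> real" where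
  "rop_sem RAdd x y = x + y"
| "rop_sem RSub x y = x - y"
| "rop_sem RMul x y = x * y"
| "rop_sem RDiv x y = x / y"

fun cmp_sem :: "cmp \<Rightarrow> 'a::linorder \<Rightarrow> 'a \<Rightarrow> bool" where
  "cmp_sem Less x y \<longleftrightarrow> x < y"
| "cmp_sem LessEq x y \<longleftrightarrow> x \<le> y"
| "cmp_sem Equal x y \<longleftrightarrow> x = y"

fun ival :: "iexp \<Rightarrow> store \<Rightarrow> int" where
  "ival (IConst k) \<sigma> = k"
| "ival (ILoad a e) \<sigma> = imem \<sigma> a (nat (ival e \<sigma>))"
| "ival (IOp f d e) \<sigma> = iop_sem f (ival d \<sigma>) (ival e \<sigma>)"

fun rval :: "rexp \<Rightarrow> store \<Rightarrow> real" where
  "rval (ROfInt e) \<sigma> = of_int (ival e \<sigma>)"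
| "rval (RLoad a e) \<sigma> = rmem \<sigma> a (nat (ival e \<sigma>))"
| "rval (ROp f d e) \<sigma> = rop_sem f (rval d \<sigma>) (rval e \<sigma>)"

fun bval :: "bexp \<Rightarrow> store \<Rightarrow> bool" where
  "bval (ICmp r d e) \<sigma> \<longleftrightarrow> cmp_sem r (ival d \<sigma>) (ival e \<sigma>)"
| "bval (RCmp r d e) \<sigma> \<longleftrightarrow> cmp_sem r (rval d \<sigma>) (rval e \<sigma>)"
| "bval (BNot b) \<sigma> \<longleftrightarrow> \<not> bval b \<sigma>"
| "bval (BAnd b b') \<sigma> \<longleftrightarrow> bval b \<sigma> \<and> bval b' \<sigma>"

text \<open>Unit cost: every constant, memory access, operation and comparison is charged 1.\<close>

fun icost :: "iexp \<Rightarrow> nat" where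
  "icost (IConst k) = 1"
| "icost (ILoad a e) = icost e + 1"
| "icost (IOp f d e) = icost d + icost e + 1"

fun rcost :: "rexp \<Rightarrow> nat" where
  "rcost (ROfInt e) = icost e + 1"
| "rcost (RLoad a e) = icost e + 1"
| "rcost (ROp f d e) = rcost d + rcost e + 1"

fun bcost :: "bexp \<Rightarrow> nat" where
  "bcost (ICmp r d e) = icost d + icost e + 1"
| "bcost (RCmp r d e) = rcost d + rcost e + 1"
| "bcost (BNot b) = bcost b + 1"
| "bcost (BAnd b b') = bcost b + bcost b' + 1"

text \<open>The memory cells that the evaluation of an expression reads.\<close>

datatype cell = ICell nat nat | RCell nat nat

fun icells :: "iexp \<Rightarrow> store \<Rightarrow> cell set" where
  "icells (IConst k) \<sigma> = {}"
| "icells (ILoad a e) \<sigma> = insert (ICell a (nat (ival e \<sigma>))) (icells e \<sigma>)"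
| "icells (IOp f d e) \<sigma> = icells d \<sigma> \<union> icells e \<sigma>"

fun rcells :: "rexp \<Rightarrow> store \<Rightarrow> cell set" where
  "rcells (ROfInt e) \<sigma> = icells e \<sigma>"
| "rcells (RLoad a e) \<sigma> = insert (RCell a (nat (ival e \<sigma>))) (icells e \<sigma>)"
| "rcells (ROp f d e) \<sigma> = rcells d \<sigma> \<union> rcells e \<sigma>"

fun bcells :: "bexp \<Rightarrow> store \<Rightarrow> cell set" where
  "bcells (ICmp r d e) \<sigma> = icells d \<sigma> \<union> icells e \<sigma>"
| "bcells (RCmp r d e) \<sigma> = rcells d \<sigma> \<union> rcells e \<sigma>"
| "bcells (BNot b) \<sigma> = bcells b \<sigma>"
| "bcells (BAnd b b') \<sigma> = bcells b \<sigma> \<union> bcells b' \<sigma>"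

fun iupd :: "nat \<Rightarrow> nat \<Rightarrow> int \<Rightarrow> store \<Rightarrow> store" where
  "iupd a i x \<sigma> = \<sigma>\<lparr>imem := (imem \<sigma>)(a := (imem \<sigma> a)(i := x))\<rparr>"

fun rupd :: "nat \<Rightarrow> nat \<Rightarrow> real \<Rightarrow> store \<Rightarrow> store" where
  "rupd a i x \<sigma> = \<sigma>\<lparr>rmem := (rmem \<sigma>)(a := (rmem \<sigma> a)(i := x))\<rparr>"

text \<open>
  \<open>exec c \<sigma> t A \<sigma>'\<close>: started in \<open>\<sigma>\<close>, the program \<open>c\<close> terminates in \<open>\<sigma>'\<close> after time \<open>t\<close>, and \<open>A\<close> is
  the set of all memory cells read or written in the course of the computation.
\<close>

inductive exec :: "com \<Rightarrow> store \<Rightarrow> nat \<Rightarrow> cell set \<Rightarrow> store \<Rightarrow> bool" where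
  Skip: "exec Skip \<sigma> 1 {} \<sigma>"
| IStore: "i = nat (ival d \<sigma>) \<Longrightarrow>
    exec (IStore a d e) \<sigma> (icost d + icost e + 1)
      (insert (ICell a i) (icells d \<sigma> \<union> icells e \<sigma>)) (iupd a i (ival e \<sigma>) \<sigma>)"
| RStore: "i = nat (ival d \<sigma>) \<Longrightarrow>
    exec (RStore a d e) \<sigma> (icost d + rcost e + 1)
      (insert (RCell a i) (icells d \<sigma> \<union> rcells e \<sigma>)) (rupd a i (rval e \<sigma>) \<sigma>)"
| Seq: "exec c \<sigma> t A \<sigma>' \<Longrightarrow> exec c' \<sigma>' t' A' \<sigma>'' \<Longrightarrow>
    exec (Seq c c') \<sigma> (t + t') (A \<union> A') \<sigma>''"
| CondTrue: "bval b \<sigma> \<Longrightarrow> exec c \<sigma> t A \<sigma>' \<Longrightarrow>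
    exec (Cond b c c') \<sigma> (bcost b + t + 1) (bcells b \<sigma> \<union> A) \<sigma>'"
| CondFalse: "\<not> bval b \<sigma> \<Longrightarrow> exec c' \<sigma> t A \<sigma>' \<Longrightarrow>
    exec (Cond b c c') \<sigma> (bcost b + t + 1) (bcells b \<sigma> \<union> A) \<sigma>'"
| LoopFalse: "\<not> bval b \<sigma> \<Longrightarrow> exec (Loop b c) \<sigma> (bcost b + 1) (bcells b \<sigma>) \<sigma>"
| LoopTrue: "bval b \<sigma> \<Longrightarrow> exec c \<sigma> t A \<sigma>' \<Longrightarrow> exec (Loop b c) \<sigma>' t' A' \<sigma>'' \<Longrightarrow>
    exec (Loop b c) \<sigma> (bcost b + t + t' + 1) (bcells b \<sigma> \<union> A \<union> A') \<sigma>''"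

inductive_cases exec_SkipE: "exec Skip \<sigma> t A \<sigma>'"
inductive_cases exec_IStoreE: "exec (IStore a d e) \<sigma> t A \<sigma>'"
inductive_cases exec_RStoreE: "exec (RStore a d e) \<sigma> t A \<sigma>'"
inductive_cases exec_SeqE: "exec (Seq c c') \<sigma> t A \<sigma>'"
inductive_cases exec_CondE: "exec (Cond b c c') \<sigma> t A \<sigma>'"
inductive_cases exec_LoopE: "exec (Loop b c) \<sigma> t A \<sigma>'"

text \<open>Execution is deterministic, so that asserting the existence of a run is unambiguous.\<close>

lemma exec_deterministic:
  "exec c \<sigma> t A \<sigma>' \<Longrightarrow> exec c \<sigma> u B \<tau> \<Longrightarrow> t = u \<and> A = B \<and> \<sigma>' = \<tau>"
proof (induction arbitrary: u B \<tau> rule: exec.induct)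
  case (Skip \<sigma>)
  then show ?case by (rule exec_SkipE) auto
next
  case (IStore i d \<sigma> a e)
  from IStore.prems show ?case by (rule exec_IStoreE) (simp add: IStore.hyps)
next
  case (RStore i d \<sigma> a e)
  from RStore.prems show ?case by (rule exec_RStoreE) (simp add: RStore.hyps)
next
  case (Seq c \<sigma> t A \<sigma>' c' t' A' \<sigma>'')
  from Seq.prems show ?case by (rule exec_SeqE) (metis Seq.IH)
next
  case (CondTrue b \<sigma> c t A \<sigma>' c')
  from CondTrue.prems show ?case
    by (rule exec_CondE) (use CondTrue.hyps(1) in \<open>auto dest!: CondTrue.IH\<close>)
next
  case (CondFalse b \<sigma> c' t A \<sigma>' c)
  from CondFalse.prems show ?case
    by (rule exec_CondE) (use CondFalse.hyps(1) in \<open>auto dest!: CondFalse.IH\<close>)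
next
  case (LoopFalse b \<sigma> c)
  from LoopFalse.prems show ?case by (rule exec_LoopE) (use LoopFalse.hyps in auto)
next
  case (LoopTrue b \<sigma> c t A \<sigma>' t' A' \<sigma>'')
  from LoopTrue.prems show ?case
    by (rule exec_LoopE) (use LoopTrue.hyps(1) in \<open>auto dest!: LoopTrue.IH\<close>)
qed

lemma finite_icells: "finite (icells e \<sigma>)"
  by (induction e) auto

lemma finite_rcells: "finite (rcells e \<sigma>)"
  by (induction e) (auto simp: finite_icells)

lemma finite_bcells: "finite (bcells b \<sigma>)"
  by (induction b) (auto simp: finite_icells finite_rcells)

lemma exec_finite_cells: "exec c \<sigma> t A \<sigma>' \<Longrightarrow> finite A"
  by (induction rule: exec.induct) (auto simp: finite_icells finite_rcells finite_bcells)

text \<open>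
  The space of a run is the total size of the arrays it uses, an array being charged for all cells
  up to the largest index accessed, including those skipped. This is at least the number of
  distinct cells accessed. Input and output cells are charged as well.
\<close>

definition space_used :: "cell set \<Rightarrow> nat" where
  "space_used A =
     (\<Sum>a | \<exists>i. ICell a i \<in> A. Suc (Max {i. ICell a i \<in> A})) +
     (\<Sum>a | \<exists>i. RCell a i \<in> A. Suc (Max {i. RCell a i \<in> A}))"


section \<open>Input and output of an algorithm for the length problems\<close>

text \<open>
  Input: cells 0 and 1 of integer array 0 hold \<open>n\<close> and \<open>g\<close>, cell \<open>i\<close> of real array 0 holds \<open>p\<^sub>i\<close>
  for \<open>1 \<le> i \<le> n\<close>. All other cells are 0.
\<close>

definition input_store :: "nat \<Rightarrow> nat \<Rightarrow> (nat \<Rightarrow> real) \<Rightarrow> store" where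
  "input_store n g p =
     \<lparr>imem = (\<lambda>a i. if a = 0 \<and> i = 0 then int n else if a = 0 \<and> i = 1 then int g else 0),
      rmem = (\<lambda>a i. if a = 0 \<and> i \<in> {1..n} then p i else 0)\<rparr>"

text \<open>
  The codeword of length \<open>l\<close> represented by the integer \<open>v\<close>: the \<open>l\<close> lowest bits of \<open>v\<close>, the most
  significant one first.
\<close>

definition bits_of :: "nat \<Rightarrow> int \<Rightarrow> bool list" where
  "bits_of l v = rev (map (bit v) [0..<l])"

text \<open>
  Output: the codeword of symbol \<open>i\<close> in the code for at most \<open>h\<close> lengths (\<open>1 \<le> h \<le> g\<close>,
  \<open>1 \<le> i \<le> n\<close>) is given by its length in integer array 1 and its bits in integer array 2, both
  at index \<open>h * n + i\<close>.
\<close>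

definition output_code :: "nat \<Rightarrow> nat \<Rightarrow> store \<Rightarrow> nat \<Rightarrow> bool list" where
  "output_code n h \<sigma> i = bits_of (nat (imem \<sigma> 1 (h * n + i))) (imem \<sigma> 2 (h * n + i))"

definition solves_within :: "com \<Rightarrow> nat \<Rightarrow> nat \<Rightarrow> (nat \<Rightarrow> real) \<Rightarrow> nat \<Rightarrow> nat \<Rightarrow> bool" where
  "solves_within prog n g p t s \<longleftrightarrow>
     (\<exists>t' A \<sigma>. exec prog (input_store n g p) t' A \<sigma> \<and> t' \<le> t \<and> space_used A \<le> s \<and>
        (\<forall>h\<in>{1..g}. solves_length_problem h n p (output_code n h \<sigma>)))"

end

theory Submission
  imports Defs
begin

text \<open>
  Build the code tree level by level. If \<open>m\<close> symbols are placed and \<open>b\<close> nodes are free on the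
  current level, then it remains to choose lengths, relative to this level, of Kraft sum at most \<open>b\<close>
  for the \<open>n - m\<close> least probable symbols. Either one free node becomes a leaf, or we descend one
  level, which doubles \<open>b\<close> and costs the total probability of the remaining symbols; as soon as
  \<open>b \<ge> n - m\<close>, nothing remains to be paid. Together with the number of lengths still allowed and a
  flag telling whether the current level is already in use, this yields a dynamic program
  with \<open>O(n\<^sup>2 g)\<close> states and two alternatives in each of them. So time and space \<open>O(n\<^sup>2 g)\<close> suffice,
  and the codes are read off the table of costs without storing decisions.
\<close>

section \<open>Prefix codes and the Kraft inequality\<close>

text \<open>The number of the level is not part of the state. A descent charges the remaining
  probability at once, so costs depend on relative lengths alone; no set of lengths is enumerated
  and no bound on the lengths has to be known beforehand. A length is counted when a level receives
  its first leaf, and further leaves on that level must not be counted again; this is what the flag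
  is for. Count and flag are packed into one index, with the flag as its parity, and this index
  never increases along the recursion. Optimality has two sides. For the lower bound, the Kraft sum
  of an arbitrary code is carried through the recursion: a leaf takes 1 from it, a descent doubles
  it. For the upper bound, the code read off occupies the nodes of the tree from left to right,
  which makes it prefix-free by construction.\<close>

lemma Kraft_inequality:
  assumes "prefix_code n c"
  shows "(\<Sum>i=1..n. (1 / 2 :: real) ^ length (c i)) \<le> 1"
proof -
  \<comment> \<open>Any common bound on the lengths would do; the sum needs no separate case for
    \<open>n = 0\<close>. The words of length \<open>L\<close> that extend different codewords are
    disjoint, and there are \<open>2 ^ L\<close> words in total.\<close>
  define L where "L = (\<Sum>i=1..n. length (c i))"
  define E where "E i = {w. length w = L \<and> prefix (c i) w}" for i
  have le: "length (c i) \<le> L" if "i \<in> {1..n}" for i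
    unfolding L_def using that by (intro member_le_sum) auto
  have E_eq: "E i = (@) (c i) ` {w. length w = L - length (c i)}" if "i \<in> {1..n}" for i
    using le[OF that] by (auto simp: E_def prefix_def image_iff)
  have words: "card {w :: bool list. length w = k} = 2 ^ k" "finite {w :: bool list. length w = k}" for k
    using card_lists_length_eq[of "UNIV :: bool set" k] finite_lists_length_eq[of "UNIV :: bool set" k]
    by auto
  have card_E: "card (E i) = 2 ^ (L - length (c i))" if "i \<in> {1..n}" for i
    unfolding E_eq[OF that] by (subst card_image) (auto simp: words inj_on_def)
  have disj: "E i \<inter> E j = {}" if "i \<in> {1..n}" "j \<in> {1..n}" "i \<noteq> j" for i j
  proof -
    have "\<not> prefix (c i) (c j)" "\<not> prefix (c j) (c i)"
      using assms that by (simp_all add: prefix_code_def)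
    then show ?thesis
      using prefix_same_cases[of "c i" _ "c j"] by (auto simp: E_def)
  qed
  have "(\<Sum>i=1..n. card (E i)) = card (\<Union>i\<in>{1..n}. E i)"
    using disj E_eq words(2) by (intro card_UN_disjoint[symmetric]) auto
  also have "\<dots> \<le> card {w :: bool list. length w = L}"
    by (intro card_mono words) (auto simp: E_def)
  finally have "(\<Sum>i=1..n. (2::nat) ^ (L - length (c i))) \<le> 2 ^ L"
    by (simp add: words card_E)
  then have "(\<Sum>i=1..n. (2::real) ^ (L - length (c i))) \<le> 2 ^ L"
    by (metis (mono_tags, lifting) of_nat_le_iff of_nat_numeral of_nat_power of_nat_sum sum.cong)
  moreover have "(\<Sum>i=1..n. (2::real) ^ (L - length (c i))) = 2 ^ L * (\<Sum>i=1..n. (1/2) ^ length (c i))"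
    unfolding sum_distrib_left by (intro sum.cong refl) (simp add: le power_diff power_one_over)
  ultimately show ?thesis by simp
qed

lemma length_bits_of [simp]: "length (bits_of l v) = l"
  by (simp add: bits_of_def)

lemma nth_bits_of: "j < l \<Longrightarrow> bits_of l v ! j = bit v (l - 1 - j)"
  by (simp add: bits_of_def rev_nth)

text \<open>Codewords list the most significant bit first, so a prefix consists of high bits, and
  cutting off the others is an integer division. The ranges ensure that \<open>bits_of\<close>
  truncates nothing.\<close>

lemma prefix_bits_of:
  assumes "prefix (bits_of l v) (bits_of l' v')" "0 \<le> v" "v < 2 ^ l" "0 \<le> v'" "v' < 2 ^ l'"
  shows "l \<le> l'" "v = v' div 2 ^ (l' - l)"
proof -
  show le: "l \<le> l'" using prefix_length_le[OF assms(1)] by simp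
  have nth: "bits_of l v ! j = bits_of l' v' ! j" if "j < l" for j
    using assms(1) that by (metis length_bits_of nth_append prefix_def)
  have "take_bit l v = take_bit l (drop_bit (l' - l) v')"
  proof (rule bit_eqI)
    fix i
    show "bit (take_bit l v) i = bit (take_bit l (drop_bit (l' - l) v')) i"
      using nth[of "l - 1 - i"] le by (auto simp: bit_take_bit_iff bit_drop_bit_eq nth_bits_of algebra_simps)
  qed
  also have "\<dots> = drop_bit (l' - l) (take_bit l' v')"
    using le by (simp add: drop_bit_take_bit)
  finally show "v = v' div 2 ^ (l' - l)"
    using assms by (simp add: take_bit_int_eq_self drop_bit_eq_div)
qed

text \<open>Node \<open>v\<close> on level \<open>l\<close> stands for the dyadic interval from
  \<open>v / 2 ^ l\<close> to \<open>(v + 1) / 2 ^ l\<close>. The second assumption says that these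
  intervals follow each other from left to right, so none of them contains another.\<close>

lemma prefix_code_bits_of:
  fixes v :: "nat \<Rightarrow> int"
  assumes "\<And>i. i \<in> {1..n} \<Longrightarrow> 0 < l i \<and> 0 \<le> v i \<and> v i < 2 ^ l i"
    and "\<And>i j. i \<in> {1..n} \<Longrightarrow> j \<in> {1..n} \<Longrightarrow> i < j \<Longrightarrow>
           l i \<le> l j \<and> (v i + 1) * 2 ^ (l j - l i) \<le> v j"
  shows "prefix_code n (\<lambda>i. bits_of (l i) (v i))"
proof -
  have less: "v i < v j div 2 ^ (l j - l i)" if "i \<in> {1..n}" "j \<in> {1..n}" "i < j" for i j
  proof -
    have "(v i + 1) * 2 ^ (l j - l i) div 2 ^ (l j - l i) \<le> v j div 2 ^ (l j - l i)"
      using assms(2)[OF that] by (intro zdiv_mono1) auto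
    then show ?thesis by simp
  qed
  have "\<not> prefix (bits_of (l i) (v i)) (bits_of (l j) (v j))"
    if "i \<in> {1..n}" "j \<in> {1..n}" "i \<noteq> j" for i j
  proof
    assume pre: "prefix (bits_of (l i) (v i)) (bits_of (l j) (v j))"
    note eq = prefix_bits_of[OF pre]
    show False
    proof (cases "i < j")
      case True
      then show False using eq(2) less[of i j] assms(1)[of i] assms(1)[of j] that by simp
    next
      \<comment> \<open>The two lengths agree here: one inequality comes from the order of the
        symbols, the other from the prefix.\<close>
      case False
      then have "j < i" using that by simp
      then show False
        using eq less[of j i] assms(1)[of i] assms(1)[of j] assms(2)[of j i] that by simp
    qed
  qed
  with assms(1) show ?thesis by (auto simp: prefix_code_def)
qed

text \<open>An output code is meaningful on \<open>{1..n}\<close> only: beyond \<open>n\<close> its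
  cells belong to the next code, and later rounds overwrite them.\<close>

lemma solves_length_problem_cong:
  assumes "\<And>i. i \<in> {1..n} \<Longrightarrow> c i = c' i"
  shows "solves_length_problem g n p c \<longleftrightarrow> solves_length_problem g n p c'"
proof -
  have "prefix_code n c \<longleftrightarrow> prefix_code n c'"
    using assms unfolding prefix_code_def by simp
  moreover have "codeword_lengths n c = codeword_lengths n c'"
    using assms unfolding codeword_lengths_def by (intro image_cong) auto
  moreover have "expected_length n p c = expected_length n p c'"
    using assms unfolding expected_length_def by (intro sum.cong) auto
  ultimately show ?thesis unfolding solves_length_problem_def is_arg_min_def by simp
qed


section \<open>The recursion for the optimal cost\<close>

definition tail_sum :: "nat \<Rightarrow> (nat \<Rightarrow> real) \<Rightarrow> nat \<Rightarrow> real" where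
  "tail_sum n p m = (\<Sum>i=Suc m..n. p i)"

lemma tail_sum_Suc: "m < n \<Longrightarrow> tail_sum n p m = p (Suc m) + tail_sum n p (Suc m)"
  unfolding tail_sum_def by (simp add: sum.atLeast_Suc_atMost)

text \<open>\<open>S\<close> and the tail have equally many elements outside their intersection, and
  \<open>p m\<close> separates these: the ones in the tail have at most this probability, the ones
  in \<open>S\<close> at least. For \<open>m = 0\<close> there is no such separator, as
  \<open>p 0\<close> is arbitrary.\<close>

lemma tail_sum_le_sum:
  assumes "decreasing_probability_vector n p" "S \<subseteq> {1..n}" "card S = n - m" "m \<le> n"
  shows "tail_sum n p m \<le> sum p S"
proof (cases "m = 0 \<or> m = n")
  case True
  have fin: "finite S" using assms(2) finite_subset by blast
  show ?thesis
  proof (cases "m = n")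
    case True
    then show ?thesis using assms fin by (simp add: tail_sum_def)
  next
    case False
    then have "S = {1..n}" using True assms by (intro card_subset_eq) auto
    then show ?thesis using True False by (simp add: tail_sum_def)
  qed
next
  case False
  let ?T = "{Suc m..n}"
  have fin: "finite S" using assms(2) finite_subset by blast
  have mono: "p j \<le> p i" if "1 \<le> i" "i \<le> j" "j \<le> n" for i j
    using assms(1) that unfolding decreasing_probability_vector_def by auto
  have "card (?T - S) + card (?T \<inter> S) = n - m"
    using card_Int_Diff[of ?T S] by simp
  moreover have "card (S - ?T) + card (?T \<inter> S) = n - m"
    using card_Int_Diff[OF fin, of ?T] assms(3) by (simp add: Int_commute)
  ultimately have card_eq: "card (?T - S) = card (S - ?T)" by simp
  have "sum p (?T - S) \<le> of_nat (card (?T - S)) * p m"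
    using False by (intro sum_bounded_above mono) auto
  also have "\<dots> \<le> sum p (S - ?T)"
    unfolding card_eq using assms(2,4) False by (intro sum_bounded_below mono) force+
  finally have "sum p (?T - S) + sum p (?T \<inter> S) \<le> sum p (S - ?T) + sum p (S \<inter> ?T)"
    by (simp add: Int_commute)
  then show ?thesis
    unfolding tail_sum_def using sum.Int_Diff[of ?T p S] sum.Int_Diff[OF fin, of p ?T]
    by (simp add: add.commute)
qed

text \<open>
  Here \<open>m\<close> symbols have codewords above the current level of the code tree, on which \<open>b\<close> nodes are
  free. Index \<open>k = 2 * h - 1\<close> allows \<open>h\<close> different lengths from this level on, whereas \<open>k = 2 * h\<close>
  allows \<open>h\<close> lengths below this level, the level itself being paid for. A step either turns
  one node into a leaf or descends, which lengthens all remaining codewords by 1.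
\<close>

function opt_cost :: "nat \<Rightarrow> (nat \<Rightarrow> real) \<Rightarrow> nat \<Rightarrow> nat \<Rightarrow> nat \<Rightarrow> real" where
  "opt_cost n p k m b =
     (if n \<le> m + b \<or> b = 0 \<or> k = 0 then 0
      else if 2 \<le> b \<and> 2 \<le> k
      then min (tail_sum n p m + opt_cost n p (k - 1 + k mod 2) m (2 * b))
             (opt_cost n p (k - k mod 2) (m + 1) (b - 1))
      else tail_sum n p m + opt_cost n p (k - 1 + k mod 2) m (2 * b))"
  by pat_completeness auto
termination
\<comment> \<open>The first leaf on a level and a descent from an even \<open>k\<close> decrease
  \<open>k\<close>; any further leaf increases \<open>m\<close>; a descent from an odd
  \<open>k\<close> doubles \<open>b\<close>, which is less than \<open>n\<close>. The table is later
  laid out in this very order.\<close>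
proof (relation "measures [\<lambda>(n, p, k, m, b). k, \<lambda>(n, p, k, m, b). n - m, \<lambda>(n, p, k, m, b). 2 * n - b]", goal_cases)
  case 1
  then show ?case by simp
next
  case (2 n p k m b)
  then show ?case by (cases "even k") (auto simp: odd_iff_mod_2_eq_one)
next
  case (3 n p k m b)
  then show ?case by (cases "even k") (auto simp: odd_iff_mod_2_eq_one)
next
  case (4 n p k m b)
  then show ?case by (cases "even k") (auto simp: odd_iff_mod_2_eq_one)
qed

declare opt_cost.simps [simp del]

lemma opt_cost_eq_0: "n \<le> m + b \<Longrightarrow> opt_cost n p k m b = 0"
  by (simp add: opt_cost.simps)

lemma opt_cost_le_leaf:
  "m + b < n \<Longrightarrow> 2 \<le> b \<Longrightarrow> 2 \<le> k \<Longrightarrow>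
     opt_cost n p k m b \<le> opt_cost n p (k - k mod 2) (m + 1) (b - 1)"
  by (subst opt_cost.simps) simp

lemma opt_cost_le_descend:
  "m + b < n \<Longrightarrow> 0 < b \<Longrightarrow> 0 < k \<Longrightarrow>
     opt_cost n p k m b \<le> tail_sum n p m + opt_cost n p (k - 1 + k mod 2) m (2 * b)"
  by (subst opt_cost.simps) simp

lemma sum_half_power_pred:
  fixes l :: "nat \<Rightarrow> nat"
  assumes "\<And>i. i \<in> S \<Longrightarrow> l i \<noteq> 0"
  shows "(\<Sum>i\<in>S. (1 / 2 :: real) ^ (l i - 1)) = 2 * (\<Sum>i\<in>S. (1 / 2) ^ l i)"
  unfolding sum_distrib_left
proof (intro sum.cong refl)
  fix i assume "i \<in> S"
  then obtain j where "l i = Suc j" using assms not0_implies_Suc by blast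
  then show "(1 / 2 :: real) ^ (l i - 1) = 2 * (1 / 2) ^ l i" by simp
qed

text \<open>
  Letting \<open>S\<close> be an arbitrary set of symbols instead of \<open>{m<..n}\<close> makes an exchange argument
  unnecessary: only the tail sums refer to the order of the probabilities.
\<close>

lemma opt_cost_le:
  "\<lbrakk>decreasing_probability_vector n p; S \<subseteq> {1..n}; card S = n - m; m \<le> n; 0 < b; 0 < k;
     (\<Sum>i\<in>S. (1 / 2 :: real) ^ l i) \<le> real b;
     card (l ` S - (if even k then {0} else {})) \<le> (k + 1) div 2\<rbrakk> \<Longrightarrow>
     opt_cost n p k m b \<le> (\<Sum>i\<in>S. p i * real (l i))"
proof (induction n p k m b arbitrary: S l rule: opt_cost.induct)
  case (1 n p k m b)
  let ?d = "k - 1 + k mod 2" and ?e = "k - k mod 2"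
  note prems = "1.prems"
  \<comment> \<open>The descending call occurs in both branches of the recursion; this merges the
    two induction hypotheses.\<close>
  have IH_descend: "opt_cost n p ?d m (2 * b) \<le> (\<Sum>i\<in>S. p i * real (l i))"
    if "\<not> (n \<le> m + b \<or> b = 0 \<or> k = 0)" "S \<subseteq> {1..n}" "card S = n - m" "m \<le> n" "0 < 2 * b" "0 < ?d"
      "(\<Sum>i\<in>S. (1 / 2 :: real) ^ l i) \<le> real (2 * b)"
      "card (l ` S - (if even ?d then {0} else {})) \<le> (?d + 1) div 2" for S l
  proof (cases "2 \<le> b \<and> 2 \<le> k")
    case True
    show ?thesis by (rule "1.IH"(1)[OF that(1) True prems(1) that(2-)])
  next
    case False
    show ?thesis by (rule "1.IH"(3)[OF that(1) False prems(1) that(2-)])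
  qed
  have pos: "p i > 0" if "i \<in> S" for i
    using prems(1) subsetD[OF prems(2) that] by (simp add: decreasing_probability_vector_def)
  have fin: "finite S" using prems(2) finite_subset by blast
  have k_cases: "(\<exists>h. k = 2 * h + 1) \<or> (\<exists>h>0. k = 2 * h)"
    using prems(6) by presburger
  show ?case
  proof (cases "n \<le> m + b")
    case True
    then show ?thesis
      using pos by (auto simp: opt_cost_eq_0 less_imp_le intro!: sum_nonneg)
  next
    case False
    then have card_S: "b < card S" using prems by simp
    show ?thesis
    proof (cases "\<exists>i\<in>S. l i = 0")
      case True
      then obtain i where i: "i \<in> S" "l i = 0" by blast
      let ?S = "S - {i}"
      have card': "card ?S = n - (m + 1)" using i fin prems by simp
      have Kraft: "(\<Sum>i\<in>?S. (1 / 2 :: real) ^ l i) \<le> real b - 1"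
        using prems(7) i fin by (simp add: sum_diff1)
      have "?S \<noteq> {}"
        using card' prems(5) False by (intro notI) simp
      then have "0 < (\<Sum>i\<in>?S. (1 / 2 :: real) ^ l i)"
        using fin by (intro sum_pos) auto
      \<comment> \<open>The removed symbol takes 1 of the Kraft sum, and the nonempty rest needs a
        positive share.\<close>
      then have b2: "2 \<le> b" using Kraft by simp
      \<comment> \<open>If only one length were left, all symbols would have length 0, and their
        Kraft sum \<open>card S\<close> would exceed \<open>b\<close>.\<close>
      have k2: "2 \<le> k"
      proof (rule ccontr)
        assume "\<not> 2 \<le> k"
        then have "k = 1" using prems(6) by simp
        then have "card (l ` S) \<le> 1" using prems by simp
        then have "\<forall>j\<in>S. l j = 0"
          using i fin by (metis card_le_Suc0_iff_eq finite_imageI image_eqI One_nat_def)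
        then have "real (card S) \<le> real b" using prems by simp
        then show False using card_S by simp
      qed
      \<comment> \<open>For odd \<open>k\<close>, length 0 is counted now and paid for; for even
        \<open>k\<close>, it was left out of the count already.\<close>
      have "card (l ` ?S - {0}) \<le> (?e + 1) div 2"
      proof -
        have "card (l ` ?S - {0}) \<le> card (l ` S - {0})"
          using fin by (intro card_mono) auto
        moreover have "card (l ` S - {0}) = card (l ` S) - 1"
          using i fin by (metis card_Diff_singleton image_eqI)
        ultimately show ?thesis using prems(8) k_cases by auto
      qed
      moreover have "even ?e" "0 < ?e" using k_cases k2 by auto
      moreover have "?S \<subseteq> {1..n}" "\<not> (n \<le> m + b \<or> b = 0 \<or> k = 0)" "m + 1 \<le> n" "0 < b - 1"
        using prems False b2 by auto
      moreover have "(\<Sum>i\<in>?S. (1 / 2 :: real) ^ l i) \<le> real (b - 1)"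
        using Kraft b2 by (simp add: of_nat_diff)
      ultimately have "opt_cost n p ?e (m + 1) (b - 1) \<le> (\<Sum>i\<in>?S. p i * real (l i))"
        using "1.IH"(2)[OF _ _ prems(1), of ?S l] b2 k2 card' by simp
      also have "\<dots> = (\<Sum>i\<in>S. p i * real (l i))"
        using i fin by (simp add: sum_diff1)
      finally show ?thesis using opt_cost_le_leaf[of m b n k p] False b2 k2 by simp
    next
      \<comment> \<open>All codewords end below this level. Relative to the next level every length
        drops by 1, the Kraft sum doubles, and the number of lengths stays the same, as 0 does not
        occur. The drop is worth \<open>sum p S\<close>, which is at least the tail sum
        charged.\<close>
      case nz: False
      let ?l = "\<lambda>i. l i - 1"
      have "inj_on (\<lambda>x. x - 1) (l ` S)"
      proof (rule inj_onI)
        fix x y assume "x \<in> l ` S" "y \<in> l ` S" "x - 1 = y - 1"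
        moreover from this have "x \<noteq> 0" "y \<noteq> 0" using nz by auto
        ultimately show "x = y" by simp
      qed
      then have "card (?l ` S) = card (l ` S)"
        using card_image[of "\<lambda>x. x - 1" "l ` S"] by (simp only: image_image)
      moreover have "l ` S - {0} = l ` S" using nz by auto
      ultimately have "card (?l ` S - (if even ?d then {0} else {})) \<le> (?d + 1) div 2"
        using prems(8) k_cases by auto
      then have "opt_cost n p ?d m (2 * b) \<le> (\<Sum>i\<in>S. p i * real (?l i))"
        using IH_descend[of S ?l] prems False sum_half_power_pred[of S l] nz k_cases by auto
      moreover have "tail_sum n p m \<le> sum p S"
        using prems by (intro tail_sum_le_sum) auto
      moreover have "(\<Sum>i\<in>S. p i * real (l i)) = sum p S + (\<Sum>i\<in>S. p i * real (?l i))"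
        unfolding sum.distrib[symmetric] using nz
        by (intro sum.cong refl) (simp add: of_nat_diff algebra_simps Suc_le_eq)
      ultimately show ?thesis using opt_cost_le_descend[of m b n k p] False prems by simp
    qed
  qed
qed


section \<open>Reading off an optimal code\<close>

text \<open>Ties are resolved in favour of a leaf. For \<open>n <= m + b\<close> the recursion has
  already ended with cost 0, and all symbols that remain become leaves on the current level.\<close>

definition leaf_step :: "nat \<Rightarrow> (nat \<Rightarrow> real) \<Rightarrow> nat \<Rightarrow> nat \<Rightarrow> nat \<Rightarrow> bool" where
  "leaf_step n p k m b \<longleftrightarrow> n \<le> m + b \<or> 2 \<le> b \<and> 2 \<le> k \<and>
     opt_cost n p (k - k mod 2) (m + 1) (b - 1) \<le> tail_sum n p m + opt_cost n p (k - 1 + k mod 2) m (2 * b)"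

text \<open>
  On level \<open>lev\<close>, the \<open>b\<close> free nodes are the rightmost ones, and \<open>v\<close> is the leftmost of these.
\<close>

definition trace_inv where
  "trace_inv n p h k m b lev v l w \<longleftrightarrow>
     m \<le> n \<and> (n \<le> m + b \<or> 0 < b \<and> 0 < k) \<and> 0 \<le> v \<and> v + int b = 2 ^ lev \<and>
     (\<Sum>i=1..m. p i * real (l i)) + real lev * tail_sum n p m + opt_cost n p k m b
       = opt_cost n p (2 * h - 1) 0 1 \<and>
     card (l ` {1..m}) + (k + 1) div 2 \<le> h \<and> (even k \<longrightarrow> lev \<in> l ` {1..m}) \<and>
     (\<forall>i\<in>{1..m}. 0 < l i \<and> l i \<le> lev \<and> 0 \<le> w i \<and> (w i + 1) * 2 ^ (lev - l i) \<le> v) \<and>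
     (\<forall>i\<in>{1..m}. \<forall>j\<in>{1..m}. i < j \<longrightarrow> l i \<le> l j \<and> (w i + 1) * 2 ^ (l j - l i) \<le> w j)"
  for w :: "nat \<Rightarrow> int"

lemma trace_inv_init:
  assumes "2 \<le> n" "1 \<le> h"
  shows "trace_inv n p h (2 * h - 1) 0 1 0 0 l w"
  using assms by (auto simp: trace_inv_def)

text \<open>The cost equation stays balanced because the share \<open>lev * p (m + 1)\<close> of the
  tail sum term becomes the cost of the new symbol. For odd \<open>k\<close> the new length may
  increase the number of lengths, but the allowance decreases by 1; for even \<open>k\<close> the
  length \<open>lev\<close> is present already.\<close>

lemma trace_inv_leaf:
  assumes inv: "trace_inv n p h k m b lev v l w" and "2 \<le> n" "m < n" and leaf: "leaf_step n p k m b"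
  shows "trace_inv n p h (k - k mod 2) (m + 1) (b - 1) lev (v + 1) (l(m + 1 := lev)) (w(m + 1 := v))"
proof -
  have b: "0 < b" using leaf \<open>m < n\<close> by (auto simp: leaf_step_def)
  \<comment> \<open>This excludes the empty codeword. On level 0 there is a single node and no
    symbol has been placed, so \<open>n >= 2\<close> forbids a leaf.\<close>
  have lev: "0 < lev"
  proof (rule ccontr)
    assume "\<not> 0 < lev"
    then have "v + int b = 1" "0 \<le> v" and "\<forall>i\<in>{1..m}. False"
      using inv by (auto simp: trace_inv_def)
    then have "b \<le> 1" "m = 0" by auto
    then show False using leaf \<open>2 \<le> n\<close> by (auto simp: leaf_step_def)
  qed
  have cost: "opt_cost n p k m b = opt_cost n p (k - k mod 2) (m + 1) (b - 1)"
  proof (cases "n \<le> m + b")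
    case True
    then show ?thesis by (simp add: opt_cost_eq_0)
  next
    case False
    then show ?thesis using leaf b
      by (subst opt_cost.simps) (auto simp: leaf_step_def min_def)
  qed
  have img: "(l(m + 1 := lev)) ` {1..m + 1} = insert lev (l ` {1..m})"
    by (auto simp: image_iff)
  have sum: "(\<Sum>i=1..m + 1. p i * real ((l(m + 1 := lev)) i))
      = (\<Sum>i=1..m. p i * real (l i)) + p (m + 1) * real lev"
    by simp
  have tail: "tail_sum n p m = p (m + 1) + tail_sum n p (m + 1)"
    using tail_sum_Suc[OF \<open>m < n\<close>] by simp
  have k_cases: "(\<exists>j. k = 2 * j + 1) \<or> (\<exists>j. k = 2 * j)" by presburger
  have card: "card (insert lev (l ` {1..m})) + (k - k mod 2 + 1) div 2 \<le> h"
  proof (cases "even k")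
    case True
    then have "insert lev (l ` {1..m}) = l ` {1..m}" "k mod 2 = 0"
      using inv by (auto simp: trace_inv_def)
    then show ?thesis using inv by (simp add: trace_inv_def)
  next
    case False
    then show ?thesis using inv card_insert_le_m1[of "Suc (card (l ` {1..m}))" "l ` {1..m}" lev] k_cases
      by (auto simp: trace_inv_def)
  qed
  have w: "(w i + 1) * 2 ^ (lev - l i) \<le> v" "l i \<le> lev" "0 < l i" "0 \<le> w i" if "i \<in> {1..m}" for i
    using inv that by (auto simp: trace_inv_def)
  have ww: "l i \<le> l j" "(w i + 1) * 2 ^ (l j - l i) \<le> w j" if "i \<in> {1..m}" "j \<in> {1..m}" "i < j" for i j
    using inv that by (auto simp: trace_inv_def)
  have v: "0 \<le> v" "v + int b = 2 ^ lev" using inv by (auto simp: trace_inv_def)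
  have "(\<Sum>i=1..m + 1. p i * real ((l(m + 1 := lev)) i)) + real lev * tail_sum n p (m + 1)
      + opt_cost n p (k - k mod 2) (m + 1) (b - 1) = opt_cost n p (2 * h - 1) 0 1"
    unfolding sum using inv cost tail by (simp add: trace_inv_def algebra_simps)
  moreover have "n \<le> m + 1 + (b - 1) \<or> 0 < b - 1 \<and> 0 < k - k mod 2"
    using leaf k_cases b by (auto simp: leaf_step_def)
  moreover have "even (k - k mod 2) \<longrightarrow> lev \<in> insert lev (l ` {1..m})" by simp
  moreover have "0 \<le> v + 1" "v + 1 + int (b - 1) = 2 ^ lev" "m + 1 \<le> n"
    using v b \<open>m < n\<close> by (simp_all add: of_nat_diff)
  moreover have "\<forall>i\<in>{1..m + 1}. 0 < (l(m + 1 := lev)) i \<and> (l(m + 1 := lev)) i \<le> lev \<and> 0 \<le> (w(m + 1 := v)) i \<and>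
      ((w(m + 1 := v)) i + 1) * 2 ^ (lev - (l(m + 1 := lev)) i) \<le> v + 1"
  proof
    fix i assume "i \<in> {1..m + 1}"
    then consider "i = m + 1" | "i \<in> {1..m}" "i \<noteq> m + 1" by fastforce
    then show "0 < (l(m + 1 := lev)) i \<and> (l(m + 1 := lev)) i \<le> lev \<and> 0 \<le> (w(m + 1 := v)) i \<and>
      ((w(m + 1 := v)) i + 1) * 2 ^ (lev - (l(m + 1 := lev)) i) \<le> v + 1"
    proof cases
      case 1
      then show ?thesis using lev v by simp
    next
      case 2
      then show ?thesis using w[OF 2(1)] by simp
    qed
  qed
  moreover have "\<forall>i\<in>{1..m + 1}. \<forall>j\<in>{1..m + 1}. i < j \<longrightarrow>
      (l(m + 1 := lev)) i \<le> (l(m + 1 := lev)) j \<and>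
      ((w(m + 1 := v)) i + 1) * 2 ^ ((l(m + 1 := lev)) j - (l(m + 1 := lev)) i) \<le> (w(m + 1 := v)) j"
  proof (intro ballI impI)
    fix i j assume ij: "i \<in> {1..m + 1}" "j \<in> {1..m + 1}" "i < j"
    then have i: "i \<in> {1..m}" "i \<noteq> m + 1" by auto
    from ij consider "j = m + 1" | "j \<in> {1..m}" "j \<noteq> m + 1" by fastforce
    then show "(l(m + 1 := lev)) i \<le> (l(m + 1 := lev)) j \<and>
      ((w(m + 1 := v)) i + 1) * 2 ^ ((l(m + 1 := lev)) j - (l(m + 1 := lev)) i) \<le> (w(m + 1 := v)) j"
    proof cases
      case 1
      then show ?thesis using i w[OF i(1)] by simp
    next
      case 2
      then show ?thesis using i ww[OF i(1) 2(1) ij(3)] by simp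
    qed
  qed
  ultimately show ?thesis
    unfolding trace_inv_def img using card by (intro conjI)
qed

text \<open>A descent clears the flag but leaves the allowance \<open>(k + 1) div 2\<close> as it
  is. The node numbers double, and so do the right ends of the intervals already occupied.\<close>

lemma trace_inv_descend:
  assumes inv: "trace_inv n p h k m b lev v l w" and not_leaf: "\<not> leaf_step n p k m b"
  shows "trace_inv n p h (k - 1 + k mod 2) m (2 * b) (lev + 1) (2 * v) l w"
proof -
  have less: "m + b < n" and b: "0 < b" "0 < k"
    using inv not_leaf by (auto simp: trace_inv_def leaf_step_def)
  have cost: "opt_cost n p k m b = tail_sum n p m + opt_cost n p (k - 1 + k mod 2) m (2 * b)"
    using less b not_leaf by (subst opt_cost.simps) (auto simp: leaf_step_def min_def)
  have k_cases: "(\<exists>j. k = 2 * j + 1) \<or> (\<exists>j>0. k = 2 * j)" using b by presburger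
  then have k: "(k - 1 + k mod 2 + 1) div 2 = (k + 1) div 2" "odd (k - 1 + k mod 2)" "0 < k - 1 + k mod 2"
    by auto
  have "(w i + 1) * 2 ^ (lev + 1 - l i) \<le> 2 * v" if "i \<in> {1..m}" for i
    using inv that by (auto simp: trace_inv_def Suc_diff_le)
  moreover have "real (lev + 1) * tail_sum n p m + opt_cost n p (k - 1 + k mod 2) m (2 * b)
      = real lev * tail_sum n p m + opt_cost n p k m b"
    using cost by (simp add: algebra_simps)
  ultimately show ?thesis
    using inv k b unfolding trace_inv_def
    by (auto simp: algebra_simps)
qed

text \<open>With all symbols placed, the tail sum and the remaining cost vanish, so the code attains
  \<open>opt_cost n p (2 * h - 1) 0 1\<close>. By \<open>opt_cost_le\<close> with
  \<open>{1..n}\<close> for \<open>S\<close>, no admissible code is cheaper.\<close>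

lemma trace_inv_final:
  assumes p: "decreasing_probability_vector n p" and "2 \<le> n" "1 \<le> h"
    and inv: "trace_inv n p h k n b lev v l w"
  shows "solves_length_problem h n p (\<lambda>i. bits_of (l i) (w i))"
proof -
  let ?c = "\<lambda>i. bits_of (l i) (w i)"
  have "w i < 2 ^ l i" if "i \<in> {1..n}" for i
  proof -
    have le: "l i \<le> lev" and "(w i + 1) * 2 ^ (lev - l i) \<le> v"
      using inv that by (auto simp: trace_inv_def)
    moreover have "v \<le> 2 ^ l i * 2 ^ (lev - l i)"
      using inv le by (simp add: trace_inv_def flip: power_add)
    ultimately have "(w i + 1) * 2 ^ (lev - l i) \<le> 2 ^ l i * 2 ^ (lev - l i)" by linarith
    then show ?thesis by simp
  qed
  then have "prefix_code n ?c"
    using inv by (intro prefix_code_bits_of) (auto simp: trace_inv_def)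
  moreover have "card (codeword_lengths n ?c) \<le> h"
    using inv by (simp add: trace_inv_def codeword_lengths_def)
  moreover have "expected_length n p ?c = opt_cost n p (2 * h - 1) 0 1"
    using inv by (simp add: trace_inv_def expected_length_def tail_sum_def opt_cost_eq_0)
  moreover have "opt_cost n p (2 * h - 1) 0 1 \<le> expected_length n p c"
    if "prefix_code n c" "card (codeword_lengths n c) \<le> h" for c
    unfolding expected_length_def using that Kraft_inequality[of n c] \<open>1 \<le> h\<close>
    by (intro opt_cost_le p) (auto simp: codeword_lengths_def)
  ultimately show ?thesis
    unfolding solves_length_problem_def is_arg_min_def by (metis linorder_not_le)
qed


section \<open>Running programs within bounds\<close>

text \<open>The program uses arrays 0, 1 and 2 of either sort.\<close>

definition cells :: "nat \<Rightarrow> cell set" where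
  "cells N = (\<Union>a\<in>{..<3}. \<Union>i\<in>{..N}. {ICell a i, RCell a i})"

lemma in_cells [simp]: "ICell a i \<in> cells N \<longleftrightarrow> a < 3 \<and> i \<le> N" "RCell a i \<in> cells N \<longleftrightarrow> a < 3 \<and> i \<le> N"
  by (auto simp: cells_def)

lemma space_used_cells:
  assumes "A \<subseteq> cells N"
  shows "space_used A \<le> 6 * Suc N"
proof -
  have bound: "(\<Sum>a | \<exists>i. f a i \<in> A. Suc (Max {i. f a i \<in> A})) \<le> 3 * Suc N"
    if f: "\<And>a i. f a i \<in> cells N \<longleftrightarrow> a < 3 \<and> i \<le> N" for f :: "nat \<Rightarrow> nat \<Rightarrow> cell"
  proof -
    let ?D = "{a. \<exists>i. f a i \<in> A}"
    have D: "?D \<subseteq> {..<3}" using assms f by auto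
    have "(\<Sum>a\<in>?D. Suc (Max {i. f a i \<in> A})) \<le> of_nat (card ?D) * Suc N"
    proof (rule sum_bounded_above)
      fix a assume "a \<in> ?D"
      then have "{i. f a i \<in> A} \<noteq> {}" by auto
      moreover have "{i. f a i \<in> A} \<subseteq> {..N}" using assms f by auto
      ultimately have "Max {i. f a i \<in> A} \<in> {..N}"
        by (meson Max_in finite_atMost finite_subset subsetD)
      then show "Suc (Max {i. f a i \<in> A}) \<le> Suc N" by simp
    qed
    also have "\<dots> \<le> 3 * Suc N" using card_mono[OF _ D] by (intro mult_right_mono) auto
    finally show ?thesis .
  qed
  show ?thesis
    unfolding space_used_def using bound[of ICell] bound[of RCell] by simp
qed

text \<open>This is total correctness for a single initial store. Time is bounded rather than given
  exactly, so that branches of different cost can share one bound.\<close>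

definition runs :: "nat \<Rightarrow> com \<Rightarrow> store \<Rightarrow> nat \<Rightarrow> (store \<Rightarrow> bool) \<Rightarrow> bool" where
  "runs N c \<sigma> t Q \<longleftrightarrow> (\<exists>t' A \<sigma>'. exec c \<sigma> t' A \<sigma>' \<and> t' \<le> t \<and> A \<subseteq> cells N \<and> Q \<sigma>')"

lemma runs_mono: "runs N c \<sigma> t Q \<Longrightarrow> t \<le> t' \<Longrightarrow> (\<And>\<sigma>'. Q \<sigma>' \<Longrightarrow> Q' \<sigma>') \<Longrightarrow> runs N c \<sigma> t' Q'"
  unfolding runs_def by (meson order_trans)

lemma runs_Seq:
  assumes "runs N c \<sigma> t Q" "\<And>\<sigma>'. Q \<sigma>' \<Longrightarrow> runs N c' \<sigma>' t' Q'"
  shows "runs N (Seq c c') \<sigma> (t + t') Q'"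
proof -
  obtain u A \<sigma>' where 1: "exec c \<sigma> u A \<sigma>'" "u \<le> t" "A \<subseteq> cells N" "Q \<sigma>'"
    using assms(1) unfolding runs_def by blast
  obtain u' A' \<sigma>'' where 2: "exec c' \<sigma>' u' A' \<sigma>''" "u' \<le> t'" "A' \<subseteq> cells N" "Q' \<sigma>''"
    using assms(2)[OF 1(4)] unfolding runs_def by blast
  show ?thesis
    unfolding runs_def using exec.Seq[OF 1(1) 2(1)] 1 2 by (meson Un_least add_mono)
qed

fun iexp_ok :: "nat \<Rightarrow> iexp \<Rightarrow> store \<Rightarrow> bool" where
  "iexp_ok N (IConst k) \<sigma> \<longleftrightarrow> True"
| "iexp_ok N (ILoad a e) \<sigma> \<longleftrightarrow> a < 3 \<and> nat (ival e \<sigma>) \<le> N \<and> iexp_ok N e \<sigma>"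
| "iexp_ok N (IOp f d e) \<sigma> \<longleftrightarrow> iexp_ok N d \<sigma> \<and> iexp_ok N e \<sigma>"

fun rexp_ok :: "nat \<Rightarrow> rexp \<Rightarrow> store \<Rightarrow> bool" where
  "rexp_ok N (ROfInt e) \<sigma> \<longleftrightarrow> iexp_ok N e \<sigma>"
| "rexp_ok N (RLoad a e) \<sigma> \<longleftrightarrow> a < 3 \<and> nat (ival e \<sigma>) \<le> N \<and> iexp_ok N e \<sigma>"
| "rexp_ok N (ROp f d e) \<sigma> \<longleftrightarrow> rexp_ok N d \<sigma> \<and> rexp_ok N e \<sigma>"

fun bexp_ok :: "nat \<Rightarrow> bexp \<Rightarrow> store \<Rightarrow> bool" where
  "bexp_ok N (ICmp r d e) \<sigma> \<longleftrightarrow> iexp_ok N d \<sigma> \<and> iexp_ok N e \<sigma>"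
| "bexp_ok N (RCmp r d e) \<sigma> \<longleftrightarrow> rexp_ok N d \<sigma> \<and> rexp_ok N e \<sigma>"
| "bexp_ok N (BNot b) \<sigma> \<longleftrightarrow> bexp_ok N b \<sigma>"
| "bexp_ok N (BAnd b b') \<sigma> \<longleftrightarrow> bexp_ok N b \<sigma> \<and> bexp_ok N b' \<sigma>"

lemma icells_subset: "iexp_ok N e \<sigma> \<Longrightarrow> icells e \<sigma> \<subseteq> cells N"
  by (induction e) auto

lemma rcells_subset: "rexp_ok N e \<sigma> \<Longrightarrow> rcells e \<sigma> \<subseteq> cells N"
  by (induction e) (use icells_subset in auto)

lemma bcells_subset: "bexp_ok N b \<sigma> \<Longrightarrow> bcells b \<sigma> \<subseteq> cells N"
  by (induction b) (use icells_subset rcells_subset in auto)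

text \<open>Loops are not evaluated by the following functions: \<^term>\<open>straight_ok\<close> fails on them.\<close>

fun straight_run :: "com \<Rightarrow> store \<Rightarrow> store" where
  "straight_run (IStore a d e) \<sigma> = iupd a (nat (ival d \<sigma>)) (ival e \<sigma>) \<sigma>"
| "straight_run (RStore a d e) \<sigma> = rupd a (nat (ival d \<sigma>)) (rval e \<sigma>) \<sigma>"
| "straight_run (Seq c c') \<sigma> = straight_run c' (straight_run c \<sigma>)"
| "straight_run (Cond b c c') \<sigma> = (if bval b \<sigma> then straight_run c \<sigma> else straight_run c' \<sigma>)"
| "straight_run _ \<sigma> = \<sigma>"

fun straight_ok :: "nat \<Rightarrow> com \<Rightarrow> store \<Rightarrow> bool" where
  "straight_ok N Skip \<sigma> \<longleftrightarrow> True"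
| "straight_ok N (IStore a d e) \<sigma> \<longleftrightarrow>
     a < 3 \<and> nat (ival d \<sigma>) \<le> N \<and> iexp_ok N d \<sigma> \<and> iexp_ok N e \<sigma>"
| "straight_ok N (RStore a d e) \<sigma> \<longleftrightarrow>
     a < 3 \<and> nat (ival d \<sigma>) \<le> N \<and> iexp_ok N d \<sigma> \<and> rexp_ok N e \<sigma>"
| "straight_ok N (Seq c c') \<sigma> \<longleftrightarrow> straight_ok N c \<sigma> \<and> straight_ok N c' (straight_run c \<sigma>)"
| "straight_ok N (Cond b c c') \<sigma> \<longleftrightarrow>
     bexp_ok N b \<sigma> \<and> (if bval b \<sigma> then straight_ok N c \<sigma> else straight_ok N c' \<sigma>)"
| "straight_ok N (Loop b c) \<sigma> \<longleftrightarrow> False"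

text \<open>Charging both branches of a conditional makes the bound independent of the store: it is
  a constant of the program text.\<close>

fun straight_time :: "com \<Rightarrow> nat" where
  "straight_time (IStore a d e) = icost d + icost e + 1"
| "straight_time (RStore a d e) = icost d + rcost e + 1"
| "straight_time (Seq c c') = straight_time c + straight_time c'"
| "straight_time (Cond b c c') = bcost b + straight_time c + straight_time c' + 1"
| "straight_time _ = 1"

lemma runs_straight:
  "straight_ok N c \<sigma> \<Longrightarrow> Q (straight_run c \<sigma>) \<Longrightarrow> runs N c \<sigma> (straight_time c) Q"
proof (induction c arbitrary: \<sigma> Q)
  case Skip
  then have "exec Skip \<sigma> 1 {} \<sigma> \<and> 1 \<le> straight_time Skip \<and> {} \<subseteq> cells N \<and> Q \<sigma>"
    by (intro conjI exec.Skip) simp_all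
  then show ?case unfolding runs_def by blast
next
  case (IStore a d e)
  then have "insert (ICell a (nat (ival d \<sigma>))) (icells d \<sigma> \<union> icells e \<sigma>) \<subseteq> cells N"
    by (simp add: icells_subset)
  then show ?case
    unfolding runs_def using exec.IStore[of "nat (ival d \<sigma>)" d \<sigma> a e, OF refl] IStore.prems(2)
    by (metis order_refl straight_run.simps(1) straight_time.simps(1))
next
  case (RStore a d e)
  then have "insert (RCell a (nat (ival d \<sigma>))) (icells d \<sigma> \<union> rcells e \<sigma>) \<subseteq> cells N"
    by (simp add: icells_subset rcells_subset)
  then show ?case
    unfolding runs_def using exec.RStore[of "nat (ival d \<sigma>)" d \<sigma> a e, OF refl] RStore.prems(2)
    by (metis order_refl straight_run.simps(2) straight_time.simps(2))
next
  case (Seq c1 c2)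
  have "runs N c1 \<sigma> (straight_time c1) (\<lambda>\<sigma>'. \<sigma>' = straight_run c1 \<sigma>)"
    using Seq by simp
  then have "runs N (Seq c1 c2) \<sigma> (straight_time c1 + straight_time c2) Q"
    by (rule runs_Seq) (use Seq in auto)
  then show ?case by simp
next
  case (Cond b c1 c2)
  show ?case
  proof (cases "bval b \<sigma>")
    case True
    then have "runs N c1 \<sigma> (straight_time c1) Q" using Cond by simp
    then obtain t A \<sigma>' where 1: "exec c1 \<sigma> t A \<sigma>'" "t \<le> straight_time c1" "A \<subseteq> cells N" "Q \<sigma>'"
      unfolding runs_def by blast
    then have "bcost b + t + 1 \<le> straight_time (Cond b c1 c2)" "bcells b \<sigma> \<union> A \<subseteq> cells N"
      using Cond.prems bcells_subset by auto
    then show ?thesis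
      unfolding runs_def using exec.CondTrue[OF True 1(1)] 1(4) by blast
  next
    case False
    then have "runs N c2 \<sigma> (straight_time c2) Q" using Cond by simp
    then obtain t A \<sigma>' where 1: "exec c2 \<sigma> t A \<sigma>'" "t \<le> straight_time c2" "A \<subseteq> cells N" "Q \<sigma>'"
      unfolding runs_def by blast
    then have "bcost b + t + 1 \<le> straight_time (Cond b c1 c2)" "bcells b \<sigma> \<union> A \<subseteq> cells N"
      using Cond.prems bcells_subset by auto
    then show ?thesis
      unfolding runs_def using exec.CondFalse[OF False 1(1)] 1(4) by blast
  qed
qed simp

text \<open>Every round decreases \<open>\<mu>\<close>, so there are at most \<open>M\<close> of
  them; the additional unit in \<open>Suc M\<close> pays for the last, failing test.\<close>

lemma runs_Loop:
  assumes step: "\<And>\<sigma>. I \<sigma> \<Longrightarrow> bval b \<sigma> \<Longrightarrow> runs N c \<sigma> t (\<lambda>\<sigma>'. I \<sigma>' \<and> \<mu> \<sigma>' < \<mu> \<sigma>)"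
    and ok: "\<And>\<sigma>. I \<sigma> \<Longrightarrow> bexp_ok N b \<sigma>"
  shows "I \<sigma> \<Longrightarrow> \<mu> \<sigma> \<le> M \<Longrightarrow>
    runs N (Loop b c) \<sigma> (Suc M * (t + bcost b + 1)) (\<lambda>\<sigma>'. I \<sigma>' \<and> \<not> bval b \<sigma>')"
proof (induction M arbitrary: \<sigma> rule: less_induct)
  case (less M)
  note cells = bcells_subset[OF ok[OF less.prems(1)]]
  show ?case
  proof (cases "bval b \<sigma>")
    case False
    then have "bcost b + 1 \<le> Suc M * (t + bcost b + 1)" by simp
    then show ?thesis
      unfolding runs_def using less.prems cells exec.LoopFalse[OF False] False by blast
  next
    case True
    obtain u A \<sigma>' where 1: "exec c \<sigma> u A \<sigma>'" "u \<le> t" "A \<subseteq> cells N" "I \<sigma>'" "\<mu> \<sigma>' < \<mu> \<sigma>"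
      using step[OF less.prems(1) True] unfolding runs_def by blast
    then have "runs N (Loop b c) \<sigma>' (Suc (M - 1) * (t + bcost b + 1)) (\<lambda>\<sigma>'. I \<sigma>' \<and> \<not> bval b \<sigma>')"
      using less.prems by (intro less.IH) auto
    then obtain u' A' \<sigma>'' where 2: "exec (Loop b c) \<sigma>' u' A' \<sigma>''" "A' \<subseteq> cells N" "I \<sigma>''" "\<not> bval b \<sigma>''"
      and "u' \<le> Suc (M - 1) * (t + bcost b + 1)"
      unfolding runs_def by blast
    moreover have "Suc (M - 1) = M" using 1(5) less.prems by simp
    ultimately have "bcost b + u + u' + 1 \<le> Suc M * (t + bcost b + 1)"
      using 1(2) by (simp add: algebra_simps)
    moreover have "bcells b \<sigma> \<union> A \<union> A' \<subseteq> cells N" using 1(3) 2(2) cells by blast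
    ultimately show ?thesis
      unfolding runs_def using exec.LoopTrue[OF True 1(1) 2(1)] 2(3,4) by blast
  qed
qed

section \<open>The program\<close>

text \<open>
  The scalar variables are kept in integer array 0, behind the input. Real array 1 holds the tail
  sums and real array 2 the table of optimal costs, in an order in which every entry depends on
  preceding ones only.
\<close>

abbreviation var :: "nat \<Rightarrow> iexp" where "var x \<equiv> ILoad 0 (IConst (int x))"
abbreviation assign :: "nat \<Rightarrow> iexp \<Rightarrow> com" where "assign x \<equiv> IStore 0 (IConst (int x))"
abbreviation iadd where "iadd \<equiv> IOp IAdd"
abbreviation isub where "isub \<equiv> IOp ISub"
abbreviation imul where "imul \<equiv> IOp IMul"
abbreviation idiv where "idiv \<equiv> IOp IDiv"
abbreviation imod where "imod \<equiv> IOp IMod"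

abbreviation "var_n \<equiv> var 0"
abbreviation "var_g \<equiv> var 1"
abbreviation "var_q \<equiv> var 2"
abbreviation "var_k \<equiv> var 3"
abbreviation "var_m \<equiv> var 4"
abbreviation "var_b \<equiv> var 5"
abbreviation "var_lev \<equiv> var 6"
abbreviation "var_v \<equiv> var 7"
abbreviation "var_h \<equiv> var 8"

text \<open>The summation runs downwards. It starts from cell \<open>n\<close> of real array 1,
  whose initial value 0 is the empty tail sum.\<close>

definition tail_body :: com where
  "tail_body = Seq
     (RStore 1 (isub var_m (IConst 1)) (ROp RAdd (RLoad 1 var_m) (RLoad 0 var_m)))
     (assign 4 (isub var_m (IConst 1)))"

definition tail_cond :: bexp where
  "tail_cond = ICmp Less (IConst 0) var_m"

definition rows :: iexp where "rows = iadd var_n (IConst 1)"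
definition cols :: iexp where "cols = iadd (imul (IConst 2) var_n) (IConst 1)"

definition address :: "iexp \<Rightarrow> iexp \<Rightarrow> iexp \<Rightarrow> iexp" where
  "address k m b = iadd (imul (iadd (imul k rows) (isub var_n m)) cols) (isub (imul (IConst 2) var_n) b)"

definition descend_index :: iexp where
  "descend_index = iadd (isub var_k (IConst 1)) (imod var_k (IConst 2))"

definition leaf_index :: iexp where
  "leaf_index = isub var_k (imod var_k (IConst 2))"

definition leaf_entry :: rexp where
  "leaf_entry = RLoad 2 (address leaf_index (iadd var_m (IConst 1)) (isub var_b (IConst 1)))"

definition descend_entry :: rexp where
  "descend_entry = ROp RAdd (RLoad 1 var_m) (RLoad 2 (address descend_index var_m (imul (IConst 2) var_b)))"

definition enough_nodes :: bexp where
  "enough_nodes = ICmp LessEq var_n (iadd var_m var_b)"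

definition two_nodes :: bexp where
  "two_nodes = BAnd (ICmp LessEq (IConst 2) var_b) (ICmp LessEq (IConst 2) var_k)"

text \<open>One loop over the addresses replaces three nested ones; the state is recovered from its
  address by division with remainder.\<close>

definition decode :: com where
  "decode = Seq (assign 5 (isub (imul (IConst 2) var_n) (imod var_q cols)))
     (Seq (assign 4 (isub var_n (imod (idiv var_q cols) rows)))
          (assign 3 (idiv (idiv var_q cols) rows)))"

text \<open>The initial 0 settles the trivial states. \<open>BAnd\<close> reads the cells of both
  its operands; nested conditionals therefore ensure that an entry is read only where the recursion
  calls it.\<close>

definition fill_entry :: com where
  "fill_entry = Seq (RStore 2 var_q (ROfInt (IConst 0)))
     (Cond enough_nodes Skip
       (Cond (BAnd (ICmp Less (IConst 0) var_b) (ICmp Less (IConst 0) var_k))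
         (Seq (RStore 2 var_q descend_entry)
           (Cond two_nodes
             (Cond (RCmp Less leaf_entry (RLoad 2 var_q)) (RStore 2 var_q leaf_entry) Skip)
             Skip))
         Skip))"

definition table_body :: com where
  "table_body = Seq decode (Seq fill_entry (assign 2 (iadd var_q (IConst 1))))"

definition table_cond :: bexp where
  "table_cond = ICmp Less var_q (imul (imul (imul (IConst 2) var_g) rows) cols)"

text \<open>The increment of \<open>var_m\<close> comes first because symbols are numbered from 1:
  the codeword written is that of symbol \<open>m + 1\<close>.\<close>

definition emit_leaf :: com where
  "emit_leaf = Seq (assign 4 (iadd var_m (IConst 1)))
     (Seq (IStore 1 (iadd (imul var_h var_n) var_m) var_lev)
     (Seq (IStore 2 (iadd (imul var_h var_n) var_m) var_v)
     (Seq (assign 5 (isub var_b (IConst 1)))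
     (Seq (assign 7 (iadd var_v (IConst 1)))
          (assign 3 leaf_index)))))"

definition descend :: com where
  "descend = Seq (assign 6 (iadd var_lev (IConst 1)))
     (Seq (assign 7 (imul (IConst 2) var_v))
     (Seq (assign 5 (imul (IConst 2) var_b))
          (assign 3 descend_index)))"

definition trace_body :: com where
  "trace_body = Cond enough_nodes emit_leaf
     (Cond two_nodes (Cond (RCmp LessEq leaf_entry descend_entry) emit_leaf descend) descend)"

definition trace_cond :: bexp where
  "trace_cond = ICmp Less var_m var_n"

definition trace_init :: com where
  "trace_init = Seq (assign 3 (isub (imul (IConst 2) var_h) (IConst 1)))
     (Seq (assign 4 (IConst 0)) (Seq (assign 5 (IConst 1))
     (Seq (assign 6 (IConst 0)) (assign 7 (IConst 0)))))"

definition output_body :: com where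
  "output_body = Seq trace_init (Seq (Loop trace_cond trace_body) (assign 8 (iadd var_h (IConst 1))))"

definition output_cond :: bexp where
  "output_cond = ICmp LessEq var_h var_g"

definition length_program :: com where
  "length_program =
     Seq (Seq (assign 4 var_n) (Loop tail_cond tail_body))
     (Seq (Loop table_cond table_body)
     (Seq (assign 8 (IConst 1)) (Loop output_cond output_body)))"


section \<open>The layout of the table\<close>

text \<open>A number in mixed radix with digits \<open>k\<close>, \<open>n - m\<close> and
  \<open>2 * n - b\<close>. The complements make larger \<open>m\<close> and larger \<open>b\<close>
  come earlier, as the recursion requires.\<close>

definition idx :: "nat \<Rightarrow> nat \<Rightarrow> nat \<Rightarrow> nat \<Rightarrow> nat" where
  "idx n k m b = (k * (n + 1) + (n - m)) * (2 * n + 1) + (2 * n - b)"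

text \<open>The largest initial index is \<open>2 * g - 1\<close>, and \<open>b\<close> stays below
  \<open>2 * n\<close> because only states with \<open>m + b < n\<close> descend.\<close>

definition table_size :: "nat \<Rightarrow> nat \<Rightarrow> nat" where
  "table_size n g = 2 * g * (n + 1) * (2 * n + 1)"

lemma pair_less:
  fixes B :: nat
  assumes "x < x' \<or> x = x' \<and> y < y'" "y < B"
  shows "x * B + y < x' * B + y'"
proof (cases "x < x'")
  case True
  then have "Suc x * B \<le> x' * B" by (intro mult_right_mono) auto
  then show ?thesis using assms(2) by simp
qed (use assms in auto)

lemma idx_less:
  assumes "k' < k \<or> k' = k \<and> (m < m' \<or> m' = m \<and> b < b')" "m \<le> n" "b' \<le> 2 * n" "m' \<le> n"
  shows "idx n k' m' b' < idx n k m b"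
proof -
  have "k' * (n + 1) + (n - m') < k * (n + 1) + (n - m) \<or> k' = k \<and> m' = m"
  proof (cases "k' = k \<and> m' = m")
    case False
    then have "k' < k \<or> k' = k \<and> n - m' < n - m" using assms by auto
    then show ?thesis using pair_less[of k' k "n - m'" "n - m" "n + 1"] by simp
  qed simp
  then show ?thesis
    unfolding idx_def using assms by (intro pair_less) auto
qed

lemma idx_less_table_size:
  assumes "k < 2 * g" "m \<le> n" "b \<le> 2 * n"
  shows "idx n k m b < table_size n g"
proof -
  have "k * (n + 1) + (n - m) < 2 * g * (n + 1) + 0"
    using assms by (intro pair_less) auto
  then have "(k * (n + 1) + (n - m)) * (2 * n + 1) + (2 * n - b) < (2 * g * (n + 1) + 0) * (2 * n + 1) + 0"
    by (intro pair_less) auto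
  then show ?thesis by (simp add: idx_def table_size_def)
qed

lemma idx_decode:
  assumes "q < table_size n g"
  defines "b \<equiv> 2 * n - q mod (2 * n + 1)"
    and "m \<equiv> n - q div (2 * n + 1) mod (n + 1)"
    and "k \<equiv> q div (2 * n + 1) div (n + 1)"
  shows "idx n k m b = q" "k < 2 * g" "m \<le> n" "b \<le> 2 * n"
proof -
  have le: "q mod (2 * n + 1) \<le> 2 * n" "q div (2 * n + 1) mod (n + 1) \<le> n"
    by (simp_all flip: less_Suc_eq_le)
  then have "n - m = q div (2 * n + 1) mod (n + 1)" "2 * n - b = q mod (2 * n + 1)"
    by (simp_all add: b_def m_def)
  then show "idx n k m b = q"
    unfolding idx_def k_def by (simp only: div_mult_mod_eq)
  show "k < 2 * g"
    using assms(1) unfolding k_def table_size_def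
    by (simp add: less_mult_imp_div_less mult.commute)
  show "m \<le> n" "b \<le> 2 * n" by (simp_all add: m_def b_def)
qed

lemma nat_address:
  assumes "m \<le> n" "b \<le> 2 * n"
  shows "nat ((int k * (int n + 1) + (int n - int m)) * (2 * int n + 1) + (2 * int n - int b)) = idx n k m b"
proof -
  have "(int k * (int n + 1) + (int n - int m)) * (2 * int n + 1) + (2 * int n - int b) = int (idx n k m b)"
    using assms by (simp only: idx_def of_nat_add of_nat_mult of_nat_diff of_nat_1 of_nat_numeral)
  then show ?thesis by (simp only: nat_int)
qed

lemma nat_descend_address:
  assumes "m + b < n" "0 < k"
  shows "nat (((int k - 1 + int k mod 2) * (int n + 1) + (int n - int m)) * (2 * int n + 1) + (2 * int n - 2 * int b))
    = idx n (k - 1 + k mod 2) m (2 * b)"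
proof -
  have "int (2 * b) = 2 * int b" "int (k - 1 + k mod 2) = int k - 1 + int k mod 2"
    using assms by (simp_all add: of_nat_diff of_nat_mod)
  then show ?thesis
    using nat_address[of m n "2 * b" "k - 1 + k mod 2"] assms by (simp only:)
qed

lemma nat_leaf_address:
  assumes "m + b < n" "0 < b"
  shows "nat (((int k - int k mod 2) * (int n + 1) + (int n - (int m + 1))) * (2 * int n + 1) + (2 * int n - (int b - 1)))
    = idx n (k - k mod 2) (m + 1) (b - 1)"
proof -
  have "int (m + 1) = int m + 1" "int (b - 1) = int b - 1" "int (k - k mod 2) = int k - int k mod 2"
    using assms by (simp_all add: of_nat_diff of_nat_mod)
  moreover have "m + 1 \<le> n" "b - 1 \<le> 2 * n" using assms by auto
  ultimately show ?thesis
    using nat_address[of "m + 1" n "b - 1" "k - k mod 2"] by (simp only:)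
qed


section \<open>Verification of the program\<close>

definition tail_inv :: "nat \<Rightarrow> nat \<Rightarrow> (nat \<Rightarrow> real) \<Rightarrow> nat \<Rightarrow> store \<Rightarrow> bool" where
  "tail_inv n g p m \<sigma> \<longleftrightarrow> imem \<sigma> 0 0 = int n \<and> imem \<sigma> 0 1 = int g \<and> imem \<sigma> 0 2 = 0 \<and>
     imem \<sigma> 0 4 = int m \<and> m \<le> n \<and>
     (\<forall>i\<in>{1..n}. rmem \<sigma> 0 i = p i) \<and> (\<forall>i\<in>{m..n}. rmem \<sigma> 1 i = tail_sum n p i)"

text \<open>The last scalar variable, \<open>var_h\<close>, is cell 8. The outputs, whose largest
  index is \<open>(g + 1) * n\<close>, need no more cells than the table.\<close>

definition memory_bound :: "nat \<Rightarrow> nat \<Rightarrow> nat" where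
  "memory_bound n g = table_size n g + 8"

definition tail_done :: "nat \<Rightarrow> nat \<Rightarrow> (nat \<Rightarrow> real) \<Rightarrow> store \<Rightarrow> bool" where
  "tail_done n g p \<sigma> \<longleftrightarrow> imem \<sigma> 0 0 = int n \<and> imem \<sigma> 0 1 = int g \<and>
     (\<forall>i\<in>{0..n}. rmem \<sigma> 1 i = tail_sum n p i)"

lemma le_memory_bound:
  assumes "1 \<le> g"
  shows "i \<le> 8 \<Longrightarrow> i \<le> memory_bound n g" "i \<le> (g + 1) * n \<Longrightarrow> i \<le> memory_bound n g"
proof -
  show "i \<le> 8 \<Longrightarrow> i \<le> memory_bound n g" by (simp add: memory_bound_def)
  have "(g + 1) * n \<le> 2 * g * (n + 1) * (2 * n + 1)"
  proof -
    have "(g + 1) * n \<le> 2 * g * (n + 1)" using assms by (intro mult_mono) auto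
    also have "\<dots> \<le> 2 * g * (n + 1) * (2 * n + 1)" by simp
    finally show ?thesis .
  qed
  then show "i \<le> (g + 1) * n \<Longrightarrow> i \<le> memory_bound n g" by (simp add: memory_bound_def table_size_def)
qed

lemma runs_tail:
  assumes "1 \<le> g"
  shows "runs (memory_bound n g) (Seq (assign 4 var_n) (Loop tail_cond tail_body)) (input_store n g p)
    (straight_time (assign 4 var_n) + Suc n * (straight_time tail_body + bcost tail_cond + 1))
    (\<lambda>\<sigma>. tail_done n g p \<sigma> \<and> imem \<sigma> 0 2 = 0)"
proof (rule runs_Seq[where Q = "tail_inv n g p n"])
  note bounds [simp] = le_memory_bound(1)[OF assms]
  show "runs (memory_bound n g) (assign 4 var_n) (input_store n g p) (straight_time (assign 4 var_n)) (tail_inv n g p n)"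
    by (rule runs_straight) (simp_all add: tail_inv_def input_store_def tail_sum_def)
  fix \<sigma> assume start: "tail_inv n g p n \<sigma>"
  let ?I = "\<lambda>\<sigma>. \<exists>m. tail_inv n g p m \<sigma>"
  have "runs (memory_bound n g) (Loop tail_cond tail_body) \<sigma>
      (Suc n * (straight_time tail_body + bcost tail_cond + 1)) (\<lambda>\<sigma>. ?I \<sigma> \<and> \<not> bval tail_cond \<sigma>)"
  proof (rule runs_Loop[where \<mu> = "\<lambda>\<sigma>. nat (imem \<sigma> 0 4)"])
    show "?I \<sigma>" "nat (imem \<sigma> 0 4) \<le> n" using start by (auto simp: tail_inv_def)
    fix \<sigma>
    show "?I \<sigma> \<Longrightarrow> bexp_ok (memory_bound n g) tail_cond \<sigma>" by (simp add: tail_cond_def)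
    assume "?I \<sigma>" and cond: "bval tail_cond \<sigma>"
    then obtain m where m: "tail_inv n g p (Suc m) \<sigma>"
      by (auto simp: tail_cond_def tail_inv_def gr0_conv_Suc)
    have le: "m + 1 \<le> memory_bound n g"
      using m assms by (intro le_memory_bound(2)) (auto simp: tail_inv_def)
    have "tail_inv n g p m (straight_run tail_body \<sigma>)"
      using m tail_sum_Suc[of m n p]
      by (auto simp: tail_inv_def tail_body_def nat_add_distrib le_Suc_eq Suc_le_eq)
    moreover have "nat (imem (straight_run tail_body \<sigma>) 0 4) < nat (imem \<sigma> 0 4)"
      using m by (auto simp: tail_inv_def tail_body_def)
    moreover have "straight_ok (memory_bound n g) tail_body \<sigma>"
      using m le by (auto simp: tail_inv_def tail_body_def nat_add_distrib)
    ultimately show "runs (memory_bound n g) tail_body \<sigma> (straight_time tail_body)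
        (\<lambda>\<sigma>'. ?I \<sigma>' \<and> nat (imem \<sigma>' 0 4) < nat (imem \<sigma> 0 4))"
      by (intro runs_straight) auto
  qed
  then show "runs (memory_bound n g) (Loop tail_cond tail_body) \<sigma>
      (Suc n * (straight_time tail_body + bcost tail_cond + 1)) (\<lambda>\<sigma>. tail_done n g p \<sigma> \<and> imem \<sigma> 0 2 = 0)"
    by (rule runs_mono) (auto simp: tail_inv_def tail_done_def tail_cond_def)
qed

section \<open>Filling the table of optimal costs\<close>

definition table_inv :: "nat \<Rightarrow> nat \<Rightarrow> (nat \<Rightarrow> real) \<Rightarrow> nat \<Rightarrow> store \<Rightarrow> bool" where
  "table_inv n g p q \<sigma> \<longleftrightarrow> tail_done n g p \<sigma> \<and>
     (\<forall>k<2 * g. \<forall>m\<le>n. \<forall>b\<le>2 * n. idx n k m b < q \<longrightarrow> rmem \<sigma> 2 (idx n k m b) = opt_cost n p k m b)"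

lemma table_invD:
  assumes "table_inv n g p q \<sigma>"
  shows "imem \<sigma> 0 0 = int n" "imem \<sigma> 0 1 = int g" "imem \<sigma> 0 (Suc 0) = int g"
    "m \<le> n \<Longrightarrow> rmem \<sigma> 1 m = tail_sum n p m" "m \<le> n \<Longrightarrow> rmem \<sigma> (Suc 0) m = tail_sum n p m"
    "k < 2 * g \<Longrightarrow> m \<le> n \<Longrightarrow> b \<le> 2 * n \<Longrightarrow> idx n k m b < q \<Longrightarrow> rmem \<sigma> 2 (idx n k m b) = opt_cost n p k m b"
  using assms by (auto simp: table_inv_def tail_done_def)

text \<open>Both alternatives lie at earlier addresses, so a single ascending sweep fills the
  table.\<close>

lemma successor_bounds:
  assumes "m + b < n" "0 < b" "0 < k" "k < 2 * g"
  shows "k - 1 + k mod 2 < 2 * g" "idx n (k - 1 + k mod 2) m (2 * b) < idx n k m b"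
    and "2 \<le> k \<Longrightarrow> k - k mod 2 < 2 * g"
    and "2 \<le> k \<Longrightarrow> idx n (k - k mod 2) (m + 1) (b - 1) < idx n k m b"
proof -
  have "k mod 2 = 0 \<or> k mod 2 = 1" by presburger
  then show "k - 1 + k mod 2 < 2 * g" "2 \<le> k \<Longrightarrow> k - k mod 2 < 2 * g" using assms by auto
  from \<open>k mod 2 = 0 \<or> k mod 2 = 1\<close> show "idx n (k - 1 + k mod 2) m (2 * b) < idx n k m b"
    using assms by (intro idx_less) auto
  from \<open>k mod 2 = 0 \<or> k mod 2 = 1\<close> show "idx n (k - k mod 2) (m + 1) (b - 1) < idx n k m b"
    using assms by (intro idx_less) auto
qed

lemma address_simps [simp]:
  "imem \<sigma> 0 0 = int n \<Longrightarrow> ival (address k m b) \<sigma> =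
     (ival k \<sigma> * (int n + 1) + (int n - ival m \<sigma>)) * (2 * int n + 1) + (2 * int n - ival b \<sigma>)"
  "iexp_ok (memory_bound n' g) (address k m b) \<sigma> \<longleftrightarrow> iexp_ok (memory_bound n' g) k \<sigma> \<and>
     iexp_ok (memory_bound n' g) m \<sigma> \<and> iexp_ok (memory_bound n' g) b \<sigma>"
  by (auto simp: address_def rows_def cols_def memory_bound_def)

text \<open>The weak inequality for \<open>q\<close> serves two purposes: equality while the entry
  itself is being computed, and \<open>q = table_size n g\<close> when the codes are read
  off.\<close>

lemma entries:
  assumes inv: "table_inv n g p q \<sigma>" and "1 \<le> g"
    and vars: "imem \<sigma> 0 3 = int k" "imem \<sigma> 0 4 = int m" "imem \<sigma> 0 5 = int b"
    and less: "m + b < n" "0 < b" "0 < k" "k < 2 * g" and q: "idx n k m b \<le> q"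
  shows "rval descend_entry \<sigma> = tail_sum n p m + opt_cost n p (k - 1 + k mod 2) m (2 * b)"
    and "rexp_ok (memory_bound n g) descend_entry \<sigma>"
    and "2 \<le> k \<Longrightarrow> rval leaf_entry \<sigma> = opt_cost n p (k - k mod 2) (m + 1) (b - 1)"
    and "2 \<le> k \<Longrightarrow> rexp_ok (memory_bound n g) leaf_entry \<sigma>"
proof -
  note bounds [simp] = le_memory_bound(1)[OF \<open>1 \<le> g\<close>]
  note succ = successor_bounds[OF less]
  have m: "m \<le> memory_bound n g"
    using less(1) by (intro le_memory_bound(2)[OF \<open>1 \<le> g\<close>]) simp
  have idx: "idx n k m b \<le> memory_bound n g"
    using idx_less_table_size[of k g m n b] less by (simp add: memory_bound_def)
  show "rval descend_entry \<sigma> = tail_sum n p m + opt_cost n p (k - 1 + k mod 2) m (2 * b)"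
    "rexp_ok (memory_bound n g) descend_entry \<sigma>"
    using succ(1,2) table_invD[OF inv] less q vars m idx nat_descend_address[OF less(1,3)]
    by (simp_all add: descend_entry_def descend_index_def)
  assume "2 \<le> k"
  then show "rval leaf_entry \<sigma> = opt_cost n p (k - k mod 2) (m + 1) (b - 1)"
    "rexp_ok (memory_bound n g) leaf_entry \<sigma>"
    using succ(3,4) table_invD[OF inv] less q vars m idx nat_leaf_address[OF less(1,2)]
    by (simp_all add: leaf_entry_def leaf_index_def)
qed

lemma fill_entry:
  assumes inv: "table_inv n g p q \<sigma>" and "1 \<le> g"
    and vars: "imem \<sigma> 0 2 = int q" "imem \<sigma> 0 3 = int k" "imem \<sigma> 0 4 = int m" "imem \<sigma> 0 5 = int b"
    and q: "idx n k m b = q" and k: "k < 2 * g" and "m \<le> n" "b \<le> 2 * n"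
  shows "straight_ok (memory_bound n g) fill_entry \<sigma> \<and>
    imem (straight_run fill_entry \<sigma>) = imem \<sigma> \<and>
    rmem (straight_run fill_entry \<sigma>) = (rmem \<sigma>)(2 := (rmem \<sigma> 2)(q := opt_cost n p k m b))"
proof -
  note bounds [simp] = le_memory_bound(1)[OF \<open>1 \<le> g\<close>]
  have q_le [simp]: "q \<le> memory_bound n g"
    using idx_less_table_size[OF k \<open>m \<le> n\<close> \<open>b \<le> 2 * n\<close>] q by (simp add: memory_bound_def)
  note [simp] = table_invD(1,2)[OF inv] vars
  define trivial where "trivial \<longleftrightarrow> n \<le> m + b \<or> b = 0 \<or> k = 0"
  show ?thesis
  proof (cases trivial)
    case True
    then have "opt_cost n p k m b = 0" by (subst opt_cost.simps) (auto simp: trivial_def)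
    then show ?thesis
      using True by (auto simp: fill_entry_def enough_nodes_def trivial_def)
  next
    case False
    then have less: "m + b < n" "0 < b" "0 < k" by (auto simp: trivial_def)
    \<comment> \<open>The invariant concerns addresses below \<open>q\<close> only, so intermediate
      values in cell \<open>q\<close> do no harm.\<close>
    have upd: "table_inv n g p q (rupd 2 q x \<sigma>)" for x
      using inv by (auto simp: table_inv_def tail_done_def)
    note E = entries[OF upd \<open>1 \<le> g\<close> _ _ _ less k, simplified vars q iupd.simps rupd.simps, simplified]
    show ?thesis
      using less E
      by (subst opt_cost.simps) (auto simp: fill_entry_def enough_nodes_def two_nodes_def min_def)
  qed
qed

lemma decode:
  assumes "imem \<sigma> 0 0 = int n" "imem \<sigma> 0 2 = int q" "1 \<le> g"
  defines "b \<equiv> 2 * n - q mod (2 * n + 1)"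
    and "m \<equiv> n - q div (2 * n + 1) mod (n + 1)"
    and "k \<equiv> q div (2 * n + 1) div (n + 1)"
  shows "straight_ok (memory_bound n g) decode \<sigma>"
    "imem (straight_run decode \<sigma>) = (imem \<sigma>)(0 := (imem \<sigma> 0)(5 := int b, 4 := int m, 3 := int k))"
    "rmem (straight_run decode \<sigma>) = rmem \<sigma>"
proof -
  note bounds [simp] = le_memory_bound(1)[OF \<open>1 \<le> g\<close>]
  have "q mod (2 * n + 1) \<le> 2 * n" "q div (2 * n + 1) mod (n + 1) \<le> n"
    by (simp_all flip: less_Suc_eq_le)
  then have b: "2 * int n - int q mod (2 * int n + 1) = int b"
    and m: "int n - int q div (2 * int n + 1) mod (int n + 1) = int m"
    and k: "int q div (2 * int n + 1) div (int n + 1) = int k"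
    unfolding b_def m_def k_def by (simp_all add: of_nat_diff of_nat_mod of_nat_div add.commute)
  show "straight_ok (memory_bound n g) decode \<sigma>"
    using assms(1,2) by (simp add: decode_def rows_def cols_def)
  show "imem (straight_run decode \<sigma>) = (imem \<sigma>)(0 := (imem \<sigma> 0)(5 := int b, 4 := int m, 3 := int k))"
    using assms(1,2) b m k by (simp add: decode_def rows_def cols_def)
  show "rmem (straight_run decode \<sigma>) = rmem \<sigma>"
    by (simp add: decode_def)
qed

lemma table_body:
  assumes inv: "table_inv n g p q \<sigma>" and q: "imem \<sigma> 0 2 = int q" "q < table_size n g" and "1 \<le> g"
  shows "straight_ok (memory_bound n g) table_body \<sigma>"
    "imem (straight_run table_body \<sigma>) 0 2 = int (Suc q)"
    "table_inv n g p (Suc q) (straight_run table_body \<sigma>)"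
proof -
  note bounds [simp] = le_memory_bound(1)[OF \<open>1 \<le> g\<close>]
  define b where "b = 2 * n - q mod (2 * n + 1)"
  define m where "m = n - q div (2 * n + 1) mod (n + 1)"
  define k where "k = q div (2 * n + 1) div (n + 1)"
  note kmb = idx_decode[OF q(2), folded b_def m_def k_def]
  let ?\<tau> = "straight_run decode \<sigma>"
  note dec = decode[OF table_invD(1)[OF inv] q(1) \<open>1 \<le> g\<close>, folded b_def m_def k_def]
  have "table_inv n g p q ?\<tau>"
    using inv dec by (simp add: table_inv_def tail_done_def)
  note fill = fill_entry[OF this \<open>1 \<le> g\<close> _ _ _ _ kmb]
  \<comment> \<open>Strict monotonicity in the lexicographic order makes addresses unique, so cell
    \<open>q\<close> stands for no other state.\<close>
  have inj: "k' = k \<and> m' = m \<and> b' = b"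
    if "idx n k' m' b' = q" "m' \<le> n" "b' \<le> 2 * n" for k' m' b'
    using idx_less[of k' k m m' b b' n] idx_less[of k k' m' m b' b n] that kmb
    by (metis less_irrefl linorder_neqE_nat)
  show "straight_ok (memory_bound n g) table_body \<sigma>"
    using fill dec q by (simp add: table_body_def)
  show "imem (straight_run table_body \<sigma>) 0 2 = int (Suc q)"
    using fill dec q by (simp add: table_body_def)
  show "table_inv n g p (Suc q) (straight_run table_body \<sigma>)"
    using inv fill dec q inj
    by (auto simp: table_body_def table_inv_def tail_done_def less_Suc_eq)
qed

lemma runs_table:
  assumes "1 \<le> g" "tail_done n g p \<sigma>" "imem \<sigma> 0 2 = 0"
  shows "runs (memory_bound n g) (Loop table_cond table_body) \<sigma>
    (Suc (table_size n g) * (straight_time table_body + bcost table_cond + 1))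
    (table_inv n g p (table_size n g))"
proof -
  note bounds [simp] = le_memory_bound(1)[OF \<open>1 \<le> g\<close>]
  let ?I = "\<lambda>\<sigma>. \<exists>q. table_inv n g p q \<sigma> \<and> imem \<sigma> 0 2 = int q \<and> q \<le> table_size n g"
  have cond: "bval table_cond \<sigma> \<longleftrightarrow> q < table_size n g"
    if "table_inv n g p q' \<sigma>" "imem \<sigma> 0 2 = int q" for \<sigma> q q'
  proof -
    have "bval table_cond \<sigma> \<longleftrightarrow> int q < int (table_size n g)"
      using table_invD(1,2)[OF that(1)] that(2)
      by (simp add: table_cond_def rows_def cols_def table_size_def algebra_simps)
    then show ?thesis by simp
  qed
  have "runs (memory_bound n g) (Loop table_cond table_body) \<sigma>
    (Suc (table_size n g) * (straight_time table_body + bcost table_cond + 1)) (\<lambda>\<sigma>. ?I \<sigma> \<and> \<not> bval table_cond \<sigma>)"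
  proof (rule runs_Loop[where \<mu> = "\<lambda>\<sigma>. table_size n g - nat (imem \<sigma> 0 2)"])
    show "?I \<sigma>" using assms by (auto simp: table_inv_def)
    show "table_size n g - nat (imem \<sigma> 0 2) \<le> table_size n g" by simp
    fix \<sigma>
    show "?I \<sigma> \<Longrightarrow> bexp_ok (memory_bound n g) table_cond \<sigma>"
      by (simp add: table_cond_def rows_def cols_def)
    assume "?I \<sigma>" "bval table_cond \<sigma>"
    then obtain q where q: "table_inv n g p q \<sigma>" "imem \<sigma> 0 2 = int q" "q < table_size n g"
      using cond by blast
    note body = table_body[OF q \<open>1 \<le> g\<close>]
    have "?I (straight_run table_body \<sigma>)"
      using body q(3) by (intro exI[of _ "Suc q"]) auto
    moreover have "table_size n g - nat (imem (straight_run table_body \<sigma>) 0 2) < table_size n g - nat (imem \<sigma> 0 2)"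
      using body(2) q by auto
    ultimately show "runs (memory_bound n g) table_body \<sigma> (straight_time table_body)
      (\<lambda>\<sigma>'. ?I \<sigma>' \<and> table_size n g - nat (imem \<sigma>' 0 2) < table_size n g - nat (imem \<sigma> 0 2))"
      using body(1) by (intro runs_straight conjI)
  qed
  then show ?thesis
    by (rule runs_mono) (use cond in force)+
qed

section \<open>Reading the codes off the table\<close>

text \<open>\<open>\<sigma>\<^sub>0\<close> is the store before the loop, whose outputs for smaller values of \<open>h\<close> are to be kept.\<close>

definition output_inv ::
    "nat \<Rightarrow> nat \<Rightarrow> (nat \<Rightarrow> real) \<Rightarrow> nat \<Rightarrow> store \<Rightarrow> nat \<Rightarrow> nat \<Rightarrow> nat \<Rightarrow> nat \<Rightarrow> store \<Rightarrow> bool" where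
  "output_inv n g p h \<sigma>\<^sub>0 k m b lev \<sigma> \<longleftrightarrow> table_inv n g p (table_size n g) \<sigma> \<and> k < 2 * g \<and>
     imem \<sigma> 0 3 = int k \<and> imem \<sigma> 0 4 = int m \<and> imem \<sigma> 0 5 = int b \<and> imem \<sigma> 0 6 = int lev \<and>
     imem \<sigma> 0 8 = int h \<and>
     trace_inv n p h k m b lev (imem \<sigma> 0 7) (\<lambda>i. nat (imem \<sigma> 1 (h * n + i))) (\<lambda>i. imem \<sigma> 2 (h * n + i)) \<and>
     (\<forall>i\<le>h * n. imem \<sigma> 1 i = imem \<sigma>\<^sub>0 1 i \<and> imem \<sigma> 2 i = imem \<sigma>\<^sub>0 2 i)"

lemma output_inv_emit_leaf:
  assumes inv: "output_inv n g p h \<sigma>\<^sub>0 k m b lev \<sigma>" and "2 \<le> n" "1 \<le> g" "h \<le> g" "m < n"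
    and leaf: "leaf_step n p k m b"
  shows "straight_ok (memory_bound n g) emit_leaf \<sigma>"
    "output_inv n g p h \<sigma>\<^sub>0 (k - k mod 2) (m + 1) (b - 1) lev (straight_run emit_leaf \<sigma>)"
proof -
  note bounds [simp] = le_memory_bound(1)[OF \<open>1 \<le> g\<close>]
  let ?\<tau> = "straight_run emit_leaf \<sigma>" and ?j = "h * n + (m + 1)"
  have vars: "imem \<sigma> 0 0 = int n" "imem \<sigma> 0 3 = int k" "imem \<sigma> 0 4 = int m" "imem \<sigma> 0 5 = int b"
    "imem \<sigma> 0 6 = int lev" "imem \<sigma> 0 8 = int h"
    using inv table_invD(1) by (auto simp: output_inv_def)
  have j: "nat (int h * int n + (int m + 1)) = ?j"
    by (simp add: nat_eq_iff)
  have "h * n \<le> g * n" using \<open>h \<le> g\<close> by (rule mult_le_mono1)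
  moreover have "(g + 1) * n = g * n + n" by simp
  ultimately have "?j \<le> (g + 1) * n" using \<open>m < n\<close> by linarith
  then have le: "?j \<le> memory_bound n g" by (rule le_memory_bound(2)[OF \<open>1 \<le> g\<close>])
  have b: "0 < b" using leaf \<open>m < n\<close> by (auto simp: leaf_step_def)
  show "straight_ok (memory_bound n g) emit_leaf \<sigma>"
    using vars j le by (simp add: emit_leaf_def leaf_index_def)
  have imem: "imem ?\<tau> = (imem \<sigma>)
      (0 := (imem \<sigma> 0)(4 := int (m + 1), 5 := int (b - 1), 7 := imem \<sigma> 0 7 + 1, 3 := int (k - k mod 2)),
       1 := (imem \<sigma> 1)(?j := int lev), 2 := (imem \<sigma> 2)(?j := imem \<sigma> 0 7))"
    and rmem: "rmem ?\<tau> = rmem \<sigma>"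
    using vars j b by (simp_all add: emit_leaf_def leaf_index_def of_nat_diff of_nat_mod fun_eq_iff)
  have "(\<lambda>i. nat (imem ?\<tau> 1 (h * n + i))) = (\<lambda>i. nat (imem \<sigma> 1 (h * n + i)))(m + 1 := lev)"
    "(\<lambda>i. imem ?\<tau> 2 (h * n + i)) = (\<lambda>i. imem \<sigma> 2 (h * n + i))(m + 1 := imem \<sigma> 0 7)"
    by (auto simp: imem)
  then have "trace_inv n p h (k - k mod 2) (m + 1) (b - 1) lev (imem ?\<tau> 0 7)
      (\<lambda>i. nat (imem ?\<tau> 1 (h * n + i))) (\<lambda>i. imem ?\<tau> 2 (h * n + i))"
    using trace_inv_leaf[OF _ \<open>2 \<le> n\<close> \<open>m < n\<close> leaf] inv by (simp add: output_inv_def imem)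
  moreover have "table_inv n g p (table_size n g) ?\<tau>"
    using inv by (simp add: output_inv_def table_inv_def tail_done_def imem rmem)
  moreover have "k - k mod 2 < 2 * g"
    using inv by (simp add: output_inv_def less_imp_diff_less)
  ultimately show "output_inv n g p h \<sigma>\<^sub>0 (k - k mod 2) (m + 1) (b - 1) lev ?\<tau>"
    using inv by (simp add: output_inv_def imem)
qed

lemma output_inv_descend:
  assumes inv: "output_inv n g p h \<sigma>\<^sub>0 k m b lev \<sigma>" and "1 \<le> g" and not_leaf: "\<not> leaf_step n p k m b"
  shows "straight_ok (memory_bound n g) descend \<sigma>"
    "output_inv n g p h \<sigma>\<^sub>0 (k - 1 + k mod 2) m (2 * b) (lev + 1) (straight_run descend \<sigma>)"
proof -
  note bounds [simp] = le_memory_bound(1)[OF \<open>1 \<le> g\<close>]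
  let ?\<tau> = "straight_run descend \<sigma>"
  have vars: "imem \<sigma> 0 3 = int k" "imem \<sigma> 0 5 = int b" "imem \<sigma> 0 6 = int lev"
    using inv by (auto simp: output_inv_def)
  have less: "m + b < n" "0 < b" "0 < k" "k < 2 * g"
    using inv not_leaf by (auto simp: output_inv_def trace_inv_def leaf_step_def)
  show "straight_ok (memory_bound n g) descend \<sigma>"
    by (simp add: descend_def descend_index_def)
  have imem: "imem ?\<tau> = (imem \<sigma>)
      (0 := (imem \<sigma> 0)(6 := int (lev + 1), 7 := 2 * imem \<sigma> 0 7, 5 := int (2 * b), 3 := int (k - 1 + k mod 2)))"
    and rmem: "rmem ?\<tau> = rmem \<sigma>"
    using vars less by (simp_all add: descend_def descend_index_def of_nat_diff of_nat_mod fun_eq_iff)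
  show "output_inv n g p h \<sigma>\<^sub>0 (k - 1 + k mod 2) m (2 * b) (lev + 1) ?\<tau>"
    using inv trace_inv_descend[OF _ not_leaf] successor_bounds(1)[OF less]
    by (simp add: output_inv_def imem rmem table_inv_def tail_done_def)
qed

lemma trace_body:
  assumes inv: "output_inv n g p h \<sigma>\<^sub>0 k m b lev \<sigma>" and "1 \<le> g"
  shows "straight_run trace_body \<sigma> = straight_run (if leaf_step n p k m b then emit_leaf else descend) \<sigma>"
    "straight_ok (memory_bound n g) trace_body \<sigma> \<longleftrightarrow>
       straight_ok (memory_bound n g) (if leaf_step n p k m b then emit_leaf else descend) \<sigma>"
proof -
  note bounds [simp] = le_memory_bound(1)[OF \<open>1 \<le> g\<close>]
  have table: "table_inv n g p (table_size n g) \<sigma>" and k: "k < 2 * g"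
    and vars: "imem \<sigma> 0 0 = int n" "imem \<sigma> 0 3 = int k" "imem \<sigma> 0 4 = int m" "imem \<sigma> 0 5 = int b"
    using inv table_invD(1) by (auto simp: output_inv_def)
  have "straight_run trace_body \<sigma> = straight_run (if leaf_step n p k m b then emit_leaf else descend) \<sigma> \<and>
    (straight_ok (memory_bound n g) trace_body \<sigma> \<longleftrightarrow>
       straight_ok (memory_bound n g) (if leaf_step n p k m b then emit_leaf else descend) \<sigma>)"
  proof (cases "n \<le> m + b")
    case True
    then show ?thesis using vars by (simp add: trace_body_def enough_nodes_def leaf_step_def)
  next
    case False
    then have less: "m + b < n" "0 < b" "0 < k"
      using inv by (auto simp: output_inv_def trace_inv_def)
    have "idx n k m b \<le> table_size n g"
      using idx_less_table_size[of k g m n b] less k by simp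
    note E = entries[OF table \<open>1 \<le> g\<close> vars(2-4) less k this]
    show ?thesis
      using False E vars by (auto simp: trace_body_def enough_nodes_def two_nodes_def leaf_step_def)
  qed
  then show "straight_run trace_body \<sigma> = straight_run (if leaf_step n p k m b then emit_leaf else descend) \<sigma>"
    "straight_ok (memory_bound n g) trace_body \<sigma> \<longleftrightarrow>
       straight_ok (memory_bound n g) (if leaf_step n p k m b then emit_leaf else descend) \<sigma>"
    by simp_all
qed

definition outputs_inv :: "nat \<Rightarrow> nat \<Rightarrow> (nat \<Rightarrow> real) \<Rightarrow> nat \<Rightarrow> store \<Rightarrow> bool" where
  "outputs_inv n g p h \<sigma> \<longleftrightarrow> table_inv n g p (table_size n g) \<sigma> \<and> imem \<sigma> 0 8 = int h \<and>
     1 \<le> h \<and> h \<le> Suc g \<and> (\<forall>h'\<in>{1..<h}. solves_length_problem h' n p (output_code n h' \<sigma>))"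

lemma runs_trace:
  assumes "2 \<le> n" "1 \<le> g" "h \<le> g" and start: "output_inv n g p h \<sigma>\<^sub>0 k m b lev \<sigma>"
  shows "runs (memory_bound n g) (Loop trace_cond trace_body) \<sigma>
    (Suc (2 * n) * (straight_time trace_body + bcost trace_cond + 1))
    (\<lambda>\<sigma>'. \<exists>k b lev. output_inv n g p h \<sigma>\<^sub>0 k n b lev \<sigma>')"
proof -
  note bounds [simp] = le_memory_bound(1)[OF \<open>1 \<le> g\<close>]
  let ?I = "\<lambda>\<sigma>. \<exists>k m b lev. output_inv n g p h \<sigma>\<^sub>0 k m b lev \<sigma>"
  \<comment> \<open>A leaf decreases \<open>n - m\<close> and keeps \<open>m + b\<close>; a descent
    keeps \<open>m\<close> and increases \<open>m + b\<close>, which is still less than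
    \<open>n\<close>. Hence there are at most \<open>2 * n\<close> steps, whatever the lengths
    are.\<close>
  let ?\<mu> = "\<lambda>\<sigma>. (n - nat (imem \<sigma> 0 4)) + (n - (nat (imem \<sigma> 0 4) + nat (imem \<sigma> 0 5)))"
  have "runs (memory_bound n g) (Loop trace_cond trace_body) \<sigma>
    (Suc (2 * n) * (straight_time trace_body + bcost trace_cond + 1)) (\<lambda>\<sigma>. ?I \<sigma> \<and> \<not> bval trace_cond \<sigma>)"
  proof (rule runs_Loop[where \<mu> = ?\<mu>])
    show "?I \<sigma>" using start by blast
    show "?\<mu> \<sigma> \<le> 2 * n" by simp
    fix \<sigma>
    show "?I \<sigma> \<Longrightarrow> bexp_ok (memory_bound n g) trace_cond \<sigma>" by (simp add: trace_cond_def)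
    assume "?I \<sigma>" and cond: "bval trace_cond \<sigma>"
    then obtain k m b lev where inv: "output_inv n g p h \<sigma>\<^sub>0 k m b lev \<sigma>" by blast
    then have vars: "imem \<sigma> 0 4 = int m" "imem \<sigma> 0 5 = int b" and "m < n"
      using cond table_invD(1)[of n g p "table_size n g" \<sigma>] by (auto simp: output_inv_def trace_cond_def)
    note body = trace_body[OF inv \<open>1 \<le> g\<close>]
    show "runs (memory_bound n g) trace_body \<sigma> (straight_time trace_body) (\<lambda>\<sigma>'. ?I \<sigma>' \<and> ?\<mu> \<sigma>' < ?\<mu> \<sigma>)"
    proof (cases "leaf_step n p k m b")
      case True
      note leaf = output_inv_emit_leaf[OF inv \<open>2 \<le> n\<close> \<open>1 \<le> g\<close> \<open>h \<le> g\<close> \<open>m < n\<close> True]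
      have "0 < b" using True \<open>m < n\<close> by (auto simp: leaf_step_def)
      then have "?\<mu> (straight_run trace_body \<sigma>) < ?\<mu> \<sigma>"
        using leaf(2) vars True body(1) \<open>m < n\<close> by (auto simp: output_inv_def nat_add_distrib)
      moreover have "?I (straight_run trace_body \<sigma>)"
        using leaf(2) body(1) True by auto
      ultimately show ?thesis
        using leaf(1) body(2) True by (intro runs_straight conjI) auto
    next
      case False
      note desc = output_inv_descend[OF inv \<open>1 \<le> g\<close> False]
      have "0 < b" "m + b < n"
        using inv False by (auto simp: output_inv_def trace_inv_def leaf_step_def)
      then have "?\<mu> (straight_run trace_body \<sigma>) < ?\<mu> \<sigma>"
        using desc(2) vars False body(1) \<open>m < n\<close> by (auto simp: output_inv_def nat_mult_distrib)
      moreover have "?I (straight_run trace_body \<sigma>)"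
        using desc(2) body(1) False by auto
      ultimately show ?thesis
        using desc(1) body(2) False by (intro runs_straight conjI) auto
    qed
  qed
  then show ?thesis
  proof (rule runs_mono)
    fix \<sigma> assume \<sigma>: "?I \<sigma> \<and> \<not> bval trace_cond \<sigma>"
    then obtain k m b lev where inv: "output_inv n g p h \<sigma>\<^sub>0 k m b lev \<sigma>" by blast
    moreover have "m = n"
      using \<sigma> inv table_invD(1)[of n g p "table_size n g" \<sigma>]
      by (auto simp: output_inv_def trace_cond_def trace_inv_def)
    ultimately show "\<exists>k b lev. output_inv n g p h \<sigma>\<^sub>0 k n b lev \<sigma>" by blast
  qed simp
qed

lemma runs_output_body:
  assumes p: "decreasing_probability_vector n p" and "2 \<le> n" "1 \<le> g" "h \<le> g"
    and inv: "outputs_inv n g p h \<sigma>"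
  shows "runs (memory_bound n g) output_body \<sigma>
    (straight_time trace_init + (Suc (2 * n) * (straight_time trace_body + bcost trace_cond + 1) +
       straight_time (assign 8 (iadd var_h (IConst 1)))))
    (outputs_inv n g p (Suc h))"
  unfolding output_body_def
proof (intro runs_Seq)
  note bounds [simp] = le_memory_bound(1)[OF \<open>1 \<le> g\<close>]
  have h: "imem \<sigma> 0 8 = int h" "1 \<le> h" using inv by (auto simp: outputs_inv_def)
  have "trace_inv n p h (2 * h - 1) 0 1 0 (imem (straight_run trace_init \<sigma>) 0 7) l w" for l w
    using trace_inv_init[OF \<open>2 \<le> n\<close> h(2)] by (simp add: trace_init_def)
  then have "output_inv n g p h \<sigma> (2 * h - 1) 0 1 0 (straight_run trace_init \<sigma>)"
    using inv h \<open>h \<le> g\<close>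
    by (simp add: output_inv_def outputs_inv_def table_inv_def tail_done_def trace_init_def of_nat_diff)
  then show "runs (memory_bound n g) trace_init \<sigma> (straight_time trace_init)
    (output_inv n g p h \<sigma> (2 * h - 1) 0 1 0)"
    by (intro runs_straight) (simp_all add: trace_init_def)
  fix \<tau> assume "output_inv n g p h \<sigma> (2 * h - 1) 0 1 0 \<tau>"
  then show "runs (memory_bound n g) (Loop trace_cond trace_body) \<tau>
      (Suc (2 * n) * (straight_time trace_body + bcost trace_cond + 1))
      (\<lambda>\<sigma>'. \<exists>k b lev. output_inv n g p h \<sigma> k n b lev \<sigma>')"
    by (rule runs_trace[OF \<open>2 \<le> n\<close> \<open>1 \<le> g\<close> \<open>h \<le> g\<close>])
next
  note bounds [simp] = le_memory_bound(1)[OF \<open>1 \<le> g\<close>]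
  have h: "1 \<le> h" using inv by (simp add: outputs_inv_def)
  let ?c = "assign 8 (iadd var_h (IConst 1))"
  fix \<tau> assume "\<exists>k b lev. output_inv n g p h \<sigma> k n b lev \<tau>"
  then obtain k b lev where out: "output_inv n g p h \<sigma> k n b lev \<tau>" by blast
  have "solves_length_problem h n p (output_code n h \<tau>)"
    using trace_inv_final[OF p \<open>2 \<le> n\<close> h] out unfolding output_inv_def output_code_def by blast
  moreover have "solves_length_problem h' n p (output_code n h' \<tau>)" if "h' \<in> {1..<h}" for h'
  proof -
    \<comment> \<open>Code \<open>h'\<close> ends at index \<open>(h' + 1) * n\<close>, inside the
      range that \<open>output_inv\<close> keeps fixed.\<close>
    have "h' * n + i \<le> h * n" if "i \<in> {1..n}" for i
    proof -
      have "h' * n + i \<le> Suc h' * n" using that by simp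
      also have "\<dots> \<le> h * n" using \<open>h' \<in> {1..<h}\<close> by (intro mult_right_mono) auto
      finally show ?thesis .
    qed
    then have "solves_length_problem h' n p (output_code n h' \<tau>) \<longleftrightarrow>
        solves_length_problem h' n p (output_code n h' \<sigma>)"
      using out by (intro solves_length_problem_cong) (simp add: output_code_def output_inv_def)
    then show ?thesis using inv that by (simp add: outputs_inv_def)
  qed
  ultimately have "solves_length_problem h' n p (output_code n h' \<tau>)" if "h' \<in> {1..<Suc h}" for h'
    using that by (cases "h' = h") auto
  moreover have "output_code n h' (straight_run ?c \<tau>) = output_code n h' \<tau>" for h'
    by (simp add: output_code_def fun_eq_iff)
  ultimately have "outputs_inv n g p (Suc h) (straight_run ?c \<tau>)"
    using out \<open>h \<le> g\<close> by (simp add: outputs_inv_def output_inv_def table_inv_def tail_done_def)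
  then show "runs (memory_bound n g) ?c \<tau> (straight_time ?c) (outputs_inv n g p (Suc h))"
    by (intro runs_straight) simp_all
qed

section \<open>Running time and space\<close>

definition tail_time :: "nat \<Rightarrow> nat" where
  "tail_time n = straight_time (assign 4 var_n) + Suc n * (straight_time tail_body + bcost tail_cond + 1)"

definition table_time :: "nat \<Rightarrow> nat \<Rightarrow> nat" where
  "table_time n g = Suc (table_size n g) * (straight_time table_body + bcost table_cond + 1)"

definition output_body_time :: "nat \<Rightarrow> nat" where
  "output_body_time n = straight_time trace_init +
     (Suc (2 * n) * (straight_time trace_body + bcost trace_cond + 1) +
      straight_time (assign 8 (iadd var_h (IConst 1))))"

definition program_time :: "nat \<Rightarrow> nat \<Rightarrow> nat" where
  "program_time n g = tail_time n + (table_time n g +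
     (straight_time (assign 8 (IConst 1)) + Suc g * (output_body_time n + bcost output_cond + 1)))"

lemma runs_outputs:
  assumes p: "decreasing_probability_vector n p" and "2 \<le> n" "1 \<le> g"
    and start: "outputs_inv n g p 1 \<sigma>"
  shows "runs (memory_bound n g) (Loop output_cond output_body) \<sigma>
    (Suc g * (output_body_time n + bcost output_cond + 1)) (outputs_inv n g p (Suc g))"
proof -
  note bounds [simp] = le_memory_bound(1)[OF \<open>1 \<le> g\<close>]
  let ?I = "\<lambda>\<sigma>. \<exists>h. outputs_inv n g p h \<sigma>"
  let ?\<mu> = "\<lambda>\<sigma>. Suc g - nat (imem \<sigma> 0 8)"
  have cond: "bval output_cond \<sigma> \<longleftrightarrow> h \<le> g" if "outputs_inv n g p h \<sigma>" for h \<sigma>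
    using that table_invD(1,2)[of n g p "table_size n g" \<sigma>] by (simp add: output_cond_def outputs_inv_def)
  have "runs (memory_bound n g) (Loop output_cond output_body) \<sigma>
    (Suc g * (output_body_time n + bcost output_cond + 1)) (\<lambda>\<sigma>. ?I \<sigma> \<and> \<not> bval output_cond \<sigma>)"
  proof (rule runs_Loop[where \<mu> = ?\<mu>])
    show "?I \<sigma>" using start by blast
    show "?\<mu> \<sigma> \<le> g" using start by (simp add: outputs_inv_def)
    fix \<sigma>
    show "?I \<sigma> \<Longrightarrow> bexp_ok (memory_bound n g) output_cond \<sigma>" by (simp add: output_cond_def)
    assume "?I \<sigma>" "bval output_cond \<sigma>"
    then obtain h where h: "outputs_inv n g p h \<sigma>" "h \<le> g" using cond by blast
    show "runs (memory_bound n g) output_body \<sigma> (output_body_time n) (\<lambda>\<sigma>'. ?I \<sigma>' \<and> ?\<mu> \<sigma>' < ?\<mu> \<sigma>)"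
      using runs_output_body[OF p \<open>2 \<le> n\<close> \<open>1 \<le> g\<close> h(2,1), folded output_body_time_def]
    proof (rule runs_mono)
      fix \<sigma>' assume next_inv: "outputs_inv n g p (Suc h) \<sigma>'"
      then have "?\<mu> \<sigma>' < ?\<mu> \<sigma>" using h by (simp add: outputs_inv_def)
      with next_inv show "?I \<sigma>' \<and> ?\<mu> \<sigma>' < ?\<mu> \<sigma>" by blast
    qed simp
  qed
  then show ?thesis
  proof (rule runs_mono)
    fix \<sigma> assume \<sigma>: "?I \<sigma> \<and> \<not> bval output_cond \<sigma>"
    then obtain h where h: "outputs_inv n g p h \<sigma>" by blast
    then have "h = Suc g" using cond[OF h] \<sigma> by (auto simp: outputs_inv_def)
    then show "outputs_inv n g p (Suc g) \<sigma>" using h by simp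
  qed simp
qed

lemma length_program_solves:
  assumes p: "decreasing_probability_vector n p" and "2 \<le> n" "1 \<le> g"
  shows "solves_within length_program n g p (program_time n g) (6 * Suc (memory_bound n g))"
proof -
  note bounds [simp] = le_memory_bound(1)[OF \<open>1 \<le> g\<close>]
  let ?c = "assign 8 (IConst 1)"
  have init: "runs (memory_bound n g) ?c \<sigma> (straight_time ?c) (outputs_inv n g p 1)"
    if "table_inv n g p (table_size n g) \<sigma>" for \<sigma>
    using that by (intro runs_straight) (simp_all add: outputs_inv_def table_inv_def tail_done_def)
  have "runs (memory_bound n g) length_program (input_store n g p) (program_time n g) (outputs_inv n g p (Suc g))"
    unfolding length_program_def program_time_def tail_time_def table_time_def
  proof (rule runs_Seq[OF runs_tail[OF \<open>1 \<le> g\<close>]])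
    fix \<sigma> assume "tail_done n g p \<sigma> \<and> imem \<sigma> 0 2 = 0"
    then have table: "runs (memory_bound n g) (Loop table_cond table_body) \<sigma>
        (Suc (table_size n g) * (straight_time table_body + bcost table_cond + 1))
        (table_inv n g p (table_size n g))"
      using runs_table[OF \<open>1 \<le> g\<close>] by blast
    show "runs (memory_bound n g) (Seq (Loop table_cond table_body) (Seq ?c (Loop output_cond output_body))) \<sigma>
        (Suc (table_size n g) * (straight_time table_body + bcost table_cond + 1) +
          (straight_time ?c + Suc g * (output_body_time n + bcost output_cond + 1)))
        (outputs_inv n g p (Suc g))"
      by (rule runs_Seq[OF table], rule runs_Seq[OF init], assumption,
          rule runs_outputs[OF p \<open>2 \<le> n\<close> \<open>1 \<le> g\<close>])
  qed
  then obtain t A \<sigma> where run: "exec length_program (input_store n g p) t A \<sigma>" "t \<le> program_time n g"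
    and A: "A \<subseteq> cells (memory_bound n g)" and out: "outputs_inv n g p (Suc g) \<sigma>"
    unfolding runs_def by blast
  moreover have "\<forall>h\<in>{1..g}. solves_length_problem h n p (output_code n h \<sigma>)"
    using out by (auto simp: outputs_inv_def)
  ultimately show ?thesis
    unfolding solves_within_def using space_used_cells[OF A] by blast
qed

text \<open>The factor 12 is \<open>2 * 2 * 3\<close>, from \<open>n + 1 <= 2 * n\<close> and
  \<open>2 * n + 1 <= 3 * n\<close>.\<close>

lemma table_size_le:
  assumes "2 \<le> n" "1 \<le> g"
  shows "table_size n g \<le> 12 * (n ^ 2 * g)" "1 \<le> n ^ 2 * g" "n \<le> n ^ 2 * g" "n * g \<le> n ^ 2 * g"
proof -
  have "2 * g * (n + 1) * (2 * n + 1) \<le> 2 * g * (2 * n) * (3 * n)"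
    using assms by (intro mult_mono) auto
  then show "table_size n g \<le> 12 * (n ^ 2 * g)"
    by (simp add: table_size_def power2_eq_square algebra_simps)
  show "n * g \<le> n ^ 2 * g" using assms by (simp add: power2_eq_square)
  moreover have "n * 1 \<le> n * g" using assms by (intro mult_left_mono) auto
  ultimately show "1 \<le> n ^ 2 * g" "n \<le> n ^ 2 * g" using assms by linarith+
qed

lemma program_time_le:
  obtains C where "\<And>n g. 2 \<le> n \<Longrightarrow> 1 \<le> g \<Longrightarrow> program_time n g \<le> C * (n ^ 2 * g)"
proof
  let ?a = "straight_time (assign 4 var_n)" and ?b = "straight_time tail_body + bcost tail_cond + 1"
    and ?c = "straight_time table_body + bcost table_cond + 1" and ?d = "straight_time (assign 8 (IConst 1))"
    and ?e = "straight_time trace_init" and ?f = "straight_time trace_body + bcost trace_cond + 1"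
    and ?h = "straight_time (assign 8 (iadd var_h (IConst 1)))" and ?k = "bcost output_cond"
  fix n g :: nat assume "2 \<le> n" "1 \<le> g"
  note size = table_size_le[OF this]
  let ?s = "n ^ 2 * g"
  \<comment> \<open>The costs of the pieces of program text do not depend on \<open>n\<close> and
    \<open>g\<close>; they enter as opaque coefficients.\<close>
  define a b c d e f h k where defs: "a = ?a" "b = ?b" "c = ?c" "d = ?d" "e = ?e" "f = ?f" "h = ?h" "k = ?k"
  have g: "Suc g \<le> 2 * ?s"
  proof -
    have "1 * g \<le> n * g" using \<open>2 \<le> n\<close> by (intro mult_right_mono) auto
    then show ?thesis using size by linarith
  qed
  have ng: "Suc g * Suc (2 * n) \<le> 6 * ?s"
  proof -
    have "Suc g * Suc (2 * n) \<le> (2 * g) * (3 * n)"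
      using \<open>2 \<le> n\<close> \<open>1 \<le> g\<close> by (intro mult_mono) auto
    also have "\<dots> \<le> 6 * ?s" using size(4) by (simp add: algebra_simps)
    finally show ?thesis .
  qed
  have "program_time n g = a + Suc n * b + Suc (table_size n g) * c + d +
      (Suc g * (e + h + k + 1) + Suc g * Suc (2 * n) * f)"
    unfolding program_time_def tail_time_def table_time_def output_body_time_def defs
    by (simp only: distrib_left mult.assoc add.assoc add.commute add.left_commute)
  also have "\<dots> \<le> ?s * a + (2 * ?s) * b + (13 * ?s) * c + ?s * d +
      ((2 * ?s) * (e + h + k + 1) + (6 * ?s) * f)"
  proof (intro add_mono mult_le_mono1 g ng)
    have "1 * a \<le> ?s * a" "1 * d \<le> ?s * d" using size(2) by (intro mult_le_mono1; simp)+
    then show "a \<le> ?s * a" "d \<le> ?s * d" by simp_all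
    show "Suc n \<le> 2 * ?s" "Suc (table_size n g) \<le> 13 * ?s" using size by linarith+
  qed
  also have "\<dots> = (a + 2 * b + 13 * c + d + 2 * (e + h + k + 1) + 6 * f) * ?s"
    by (simp only: distrib_left distrib_right mult.assoc mult.commute mult.left_commute)
  finally show "program_time n g \<le> (?a + 2 * ?b + 13 * ?c + ?d + 2 * (?e + ?h + ?k + 1) + 6 * ?f) * ?s"
    by (simp only: defs)
qed

theorem mainTheorem4:
  shows "\<exists>(prog :: com) (T :: nat \<Rightarrow> nat \<Rightarrow> nat) (S :: nat \<Rightarrow> nat \<Rightarrow> nat).
    (\<forall>n g p. 2 \<le> n \<longrightarrow> 1 \<le> g \<longrightarrow> decreasing_probability_vector n p \<longrightarrow>
       solves_within prog n g p (T n g) (S n g)) \<and>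
    (\<lambda>(n, g). real (T n g)) \<in> O[principal ({2..} \<times> {1..})](
       \<lambda>(n, g). real n ^ 3 * log 2 (real n) ^ g * real g ^ 3) \<and>
    (\<lambda>(n, g). real (S n g)) \<in> O[principal ({2..} \<times> {1..})](
       \<lambda>(n, g). real n ^ 2 * real g) \<and>
    (\<lambda>n. real (T n 2)) \<in> O[principal {2..}](\<lambda>n. real n ^ 3 * log 2 (real n) ^ 2) \<and>
    (\<lambda>n. real (S n 2)) \<in> O[principal {2..}](\<lambda>n. real n ^ 2)"
proof -
  obtain C where C: "\<And>n g. 2 \<le> n \<Longrightarrow> 1 \<le> g \<Longrightarrow> program_time n g \<le> C * (n ^ 2 * g)"
    using program_time_le by blast
  let ?S = "\<lambda>n g. 6 * Suc (memory_bound n g)"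
  have time: "real (program_time n g) \<le> C * (real n ^ 3 * log 2 (real n) ^ g * real g ^ 3)"
    if "2 \<le> n" "1 \<le> g" for n g
  proof -
    \<comment> \<open>Since \<open>n >= 2\<close>, the logarithm is at least 1, so every factor of
      the required bound dominates the corresponding factor of \<open>n ^ 2 * g\<close>.\<close>
    have log: "1 \<le> log 2 (real n)" using that by (simp add: le_log_iff)
    have "real n ^ 2 * 1 * real g ^ 1 \<le> real n ^ 3 * log 2 (real n) ^ g * real g ^ 3"
      using that log by (intro mult_mono power_increasing one_le_power) auto
    then have "C * (real n ^ 2 * real g) \<le> C * (real n ^ 3 * log 2 (real n) ^ g * real g ^ 3)"
      by (intro mult_left_mono) auto
    moreover have "real (program_time n g) \<le> C * (real n ^ 2 * real g)"
      using C[OF that] by (metis of_nat_le_iff of_nat_mult of_nat_power)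
    ultimately show ?thesis by linarith
  qed
  \<comment> \<open>Each of the six arrays has at most \<open>table_size n g + 9\<close> cells,
    hence at most \<open>21 * (n ^ 2 * g)\<close>, and \<open>126 = 6 * 21\<close>.\<close>
  have space: "real (?S n g) \<le> 126 * (real n ^ 2 * real g)" if "2 \<le> n" "1 \<le> g" for n g
  proof -
    define s where "s = n ^ 2 * g"
    have "?S n g \<le> 126 * s"
      using table_size_le(1,2)[OF that, folded s_def] by (simp add: memory_bound_def)
    then have "?S n g \<le> 126 * (n ^ 2 * g)" by (simp only: s_def)
    then have "real (?S n g) \<le> real (126 * (n ^ 2 * g))" by (simp only: of_nat_le_iff)
    then show ?thesis by simp
  qed
  show ?thesis
  proof (intro exI conjI allI impI)
    show "solves_within length_program n g p (program_time n g) (?S n g)"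
      if "2 \<le> n" "1 \<le> g" "decreasing_probability_vector n p" for n g p
      using length_program_solves that by blast
    show "(\<lambda>(n, g). real (program_time n g)) \<in> O[principal ({2..} \<times> {1..})](
        \<lambda>(n, g). real n ^ 3 * log 2 (real n) ^ g * real g ^ 3)"
      by (rule bigoI[where c = C])
        (auto simp: eventually_principal intro: order_trans[OF time] mult_left_mono)
    show "(\<lambda>(n, g). real (?S n g)) \<in> O[principal ({2..} \<times> {1..})](\<lambda>(n, g). real n ^ 2 * real g)"
      using space by (intro bigoI[where c = 126]) (auto simp: eventually_principal)
    \<comment> \<open>For \<open>g = 2\<close>, the factor \<open>g ^ 3\<close> yields 8, and the
      factor \<open>g\<close> in the space bound yields \<open>252 = 2 * 126\<close>.\<close>
    show "(\<lambda>n. real (program_time n 2)) \<in> O[principal {2..}](\<lambda>n. real n ^ 3 * log 2 (real n) ^ 2)"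
      using time[of _ 2] by (intro bigoI[where c = "8 * C"]) (auto simp: eventually_principal algebra_simps)
    show "(\<lambda>n. real (?S n 2)) \<in> O[principal {2..}](\<lambda>n. real n ^ 2)"
      using space[of _ 2] by (intro bigoI[where c = 252]) (auto simp: eventually_principal)
  qed
qed

end
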